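(* Let $\mu$ be a Borel probability measure on $c_0$ that is non-aligned, fully supported and of product type. Then for $\mu^{\mathbb N}$-almost every sequence $(x^{(i)})_{i\in\mathbb N}\in c_0^{\mathbb N}$, the countable set $V=\{x^{(i)}\colon i\in\mathbb N\}$ is Rado.
   Context: $c_0$ denotes the Banach space of real sequences $x=(x_n)_{n\in\mathbb N}$ converging to $0$, with norm $\|x\|=\sup_n|x_n|$. An affine coordinate hyperplane in $c_0$ is a set $\{x\in c_0\colon x_j=\alpha\}$ with $j\in\mathbb N$, $\alpha\in\mathbb R$. A measure $\mu$ on $c_0$ is non-aligned if $\mu(H)=0$ for every affine coordinate hyperplane $H$; fully supported if $\mu(U)>0$ for every nonempty open $U\subseteq c_0$; and of product type if, viewed as a measure on $\mathbb R^{\mathbb N}$ (giving full mass to $c_0$), it is of the form $\prod_{n=1}^\infty\nu_n$ for Borel probability measures $\nu_n$ on $\mathbb R$ (i.e. the coordinates are independent, the $n$th having law $\nu_n$). $\mu^{\mathbb N}$ is the product measure on $c_0^{\mathbb N}$. For a normed space $X$, a countable $V\subseteq X$, $\delta>0$ and $p\in(0,1)$, the random graph $\mathrm{LARG}(V,\delta,p)$ has vertex set $V$, and for each pair of distinct $u,v\in V$ with $\|u-v\|<\delta$ the edge $uv$ is included independently with probability $p$ (no other edges). A countable dense set $V\subseteq X$ is Rado if for every $\delta>0$ and every $p\in(0,1)$ there is a graph $\Gamma$ such that with probability $1$, $\mathrm{LARG}(V,\delta,p)$ is isomorphic to $\Gamma$. *)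

theory Defs
  imports "HOL-Probability.Probability"
begin

text \<open>The Banach space \<open>c\<^sub>0\<close> of real null sequences with the supremum norm.\<close>

typedef c0 = "{x :: nat \<Rightarrow> real. x \<longlonglongrightarrow> 0}"
  morphisms coord Abs_c0
  by (rule exI[of _ "\<lambda>_. 0"]) simp

setup_lifting type_definition_c0

lemma coord_tendsto_0: "coord x \<longlonglongrightarrow> 0"
  using coord[of x] by simp

lemma bdd_above_coord: "bdd_above (range (\<lambda>n. \<bar>coord x n\<bar>))"
proof -
  have "Bseq (coord x)"
    using coord_tendsto_0 convergentI convergent_imp_Bseq by blast
  then obtain K where "\<And>n. norm (coord x n) \<le> K"
    by (auto simp: Bseq_def)
  then show ?thesis by (intro bdd_aboveI2[of _ _ K]) simp
qed

instantiation c0 :: real_vector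
begin

lift_definition zero_c0 :: c0 is "\<lambda>_. 0" by simp

lift_definition plus_c0 :: "c0 \<Rightarrow> c0 \<Rightarrow> c0" is "\<lambda>x y n. x n + y n"
  using tendsto_add_zero by blast

lift_definition uminus_c0 :: "c0 \<Rightarrow> c0" is "\<lambda>x n. - x n"
  using tendsto_minus by fastforce

lift_definition minus_c0 :: "c0 \<Rightarrow> c0 \<Rightarrow> c0" is "\<lambda>x y n. x n - y n"
  using tendsto_diff by fastforce

lift_definition scaleR_c0 :: "real \<Rightarrow> c0 \<Rightarrow> c0" is "\<lambda>r x n. r * x n"
  using tendsto_mult_right_zero by blast

instance
  by standard (transfer; simp add: fun_eq_iff algebra_simps)+

end

lemmas coord_simps [simp] =
  zero_c0.rep_eq plus_c0.rep_eq uminus_c0.rep_eq minus_c0.rep_eq scaleR_c0.rep_eq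

lemma c0_eqI: "(\<And>n. coord x n = coord y n) \<Longrightarrow> x = y"
  by (metis coord_inject ext)

instantiation c0 :: real_normed_vector
begin

definition norm_c0 :: "c0 \<Rightarrow> real" where
  "norm_c0 x = (SUP n. \<bar>coord x n\<bar>)"

definition sgn_c0 :: "c0 \<Rightarrow> c0" where
  "sgn_c0 x = inverse (norm x) *\<^sub>R x"

definition dist_c0 :: "c0 \<Rightarrow> c0 \<Rightarrow> real" where
  "dist_c0 x y = norm (x - y)"

definition uniformity_c0 :: "(c0 \<times> c0) filter" where
  "uniformity_c0 = (INF e\<in>{0<..}. principal {(x, y). dist x y < e})"

definition open_c0 :: "c0 set \<Rightarrow> bool" where
  "open_c0 U \<longleftrightarrow> (\<forall>x\<in>U. eventually (\<lambda>(x', y). x' = x \<longrightarrow> y \<in> U) uniformity)"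

lemma abs_coord_le_norm: "\<bar>coord x n\<bar> \<le> norm x" for x :: c0
  unfolding norm_c0_def by (rule cSUP_upper[OF UNIV_I bdd_above_coord])

lemma norm_c0_leI: "(\<And>n. \<bar>coord x n\<bar> \<le> K) \<Longrightarrow> norm x \<le> K" for x :: c0
  unfolding norm_c0_def by (rule cSUP_least) auto

instance
proof
  fix x y :: c0 and a :: real
  have nonneg: "0 \<le> norm z" for z :: c0
    using abs_coord_le_norm[of z 0] by linarith
  show "norm x = 0 \<longleftrightarrow> x = 0"
  proof
    assume "norm x = 0"
    then show "x = 0"
      using abs_coord_le_norm[of x] by (intro c0_eqI) simp
  next
    assume "x = 0"
    then show "norm x = 0" by (simp add: norm_c0_def)
  qed
  show "norm (x + y) \<le> norm x + norm y"
    by (intro norm_c0_leI)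
       (simp, intro order_trans[OF abs_triangle_ineq] add_mono abs_coord_le_norm)
  have le: "norm (b *\<^sub>R z) \<le> \<bar>b\<bar> * norm z" for b and z :: c0
    by (intro norm_c0_leI) (simp add: abs_mult mult_left_mono abs_coord_le_norm)
  show "norm (a *\<^sub>R x) = \<bar>a\<bar> * norm x"
  proof (cases "a = 0")
    case True
    then show ?thesis using le[of a x] nonneg[of "a *\<^sub>R x"] by simp
  next
    case False
    have "\<bar>a\<bar> * norm x \<le> norm (a *\<^sub>R x)"
      using le[of "inverse a" "a *\<^sub>R x"] False by (simp add: field_simps)
    then show ?thesis using le[of a x] by simp
  qed
qed (rule dist_c0_def sgn_c0_def uniformity_c0_def open_c0_def)+

end

instance c0 :: banach
proof
  fix X :: "nat \<Rightarrow> c0"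
  assume C: "Cauchy X"
  have Cn: "Cauchy (\<lambda>m. coord (X m) n)" for n
  proof (rule metric_CauchyI)
    fix e :: real assume "e > 0"
    then obtain M where M: "\<forall>m\<ge>M. \<forall>k\<ge>M. dist (X m) (X k) < e"
      using metric_CauchyD[OF C] by blast
    have "dist (coord (X m) n) (coord (X k) n) \<le> dist (X m) (X k)" for m k
      using abs_coord_le_norm[of "X m - X k" n] by (simp add: dist_norm)
    then show "\<exists>M. \<forall>m\<ge>M. \<forall>k\<ge>M. dist (coord (X m) n) (coord (X k) n) < e"
      using M by (meson order_le_less_trans)
  qed
  define l where "l n = lim (\<lambda>m. coord (X m) n)" for n
  have l: "(\<lambda>m. coord (X m) n) \<longlonglongrightarrow> l n" for n
    unfolding l_def using Cn Cauchy_convergent convergent_LIMSEQ_iff by blast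
  have unif: "\<exists>M. \<forall>m\<ge>M. \<forall>n. \<bar>coord (X m) n - l n\<bar> \<le> e" if e: "e > 0" for e
  proof -
    obtain M where M: "\<And>m k. m \<ge> M \<Longrightarrow> k \<ge> M \<Longrightarrow> norm (X m - X k) < e"
      using metric_CauchyD[OF C e] by (auto simp: dist_norm)
    have "\<bar>coord (X m) n - l n\<bar> \<le> e" if "m \<ge> M" for m n
    proof (rule LIMSEQ_le_const2)
      show "(\<lambda>k. \<bar>coord (X m) n - coord (X k) n\<bar>) \<longlonglongrightarrow> \<bar>coord (X m) n - l n\<bar>"
        by (intro tendsto_intros l)
      have "\<bar>coord (X m) n - coord (X k) n\<bar> \<le> e" if "k \<ge> M" for k
        using abs_coord_le_norm[of "X m - X k" n] M[OF \<open>m \<ge> M\<close> that] by simp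
      then show "\<exists>N. \<forall>k\<ge>N. \<bar>coord (X m) n - coord (X k) n\<bar> \<le> e" by blast
    qed
    then show ?thesis by blast
  qed
  have "l \<longlonglongrightarrow> 0"
  proof (rule LIMSEQ_I)
    fix e :: real assume "e > 0"
    then obtain M where M: "\<And>n. \<bar>coord (X M) n - l n\<bar> \<le> e / 2"
      using unif[of "e / 2"] by auto
    obtain N where "\<And>n. n \<ge> N \<Longrightarrow> \<bar>coord (X M) n\<bar> < e / 2"
      using LIMSEQ_D[OF coord_tendsto_0, of "e / 2" "X M"] \<open>e > 0\<close> by auto
    then have "norm (l n - 0) < e" if "n \<ge> N" for n
      using M[of n] that by (smt (verit, best) field_sum_of_halves real_norm_def)
    then show "\<exists>N. \<forall>n\<ge>N. norm (l n - 0) < e" by blast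
  qed
  then have cl: "coord (Abs_c0 l) = l" by (simp add: Abs_c0_inverse)
  have "X \<longlonglongrightarrow> Abs_c0 l"
  proof (rule LIMSEQ_I)
    fix e :: real assume "e > 0"
    then obtain M where "\<forall>m\<ge>M. \<forall>n. \<bar>coord (X m) n - l n\<bar> \<le> e / 2"
      using unif[of "e / 2"] by auto
    then have "norm (X m - Abs_c0 l) \<le> e / 2" if "m \<ge> M" for m
      using that by (intro norm_c0_leI) (simp add: cl)
    then show "\<exists>M. \<forall>m\<ge>M. norm (X m - Abs_c0 l) < e"
      using \<open>e > 0\<close> by (intro exI[of _ M]) force
  qed
  then show "convergent X" by (rule convergentI)
qed

lemma continuous_on_coord: "continuous_on UNIV (\<lambda>x. coord x n)"
proof -
  have "bounded_linear (\<lambda>x. coord x n)"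
    by (rule bounded_linear_intro[of _ 1]) (simp_all add: abs_coord_le_norm)
  then show ?thesis by (rule linear_continuous_on)
qed

lemma measurable_coord: "coord \<in> borel \<rightarrow>\<^sub>M (\<Pi>\<^sub>M n\<in>UNIV. borel)"
  by (rule measurable_PiM_single')
     (auto intro: borel_measurable_continuous_onI continuous_on_coord)

subsection \<open>Measures on \<open>c\<^sub>0\<close>\<close>

definition borel_prob :: "'a::topological_space measure \<Rightarrow> bool" where
  "borel_prob M \<longleftrightarrow> prob_space M \<and> sets M = sets borel"

definition coord_hyperplane :: "nat \<Rightarrow> real \<Rightarrow> c0 set" where
  "coord_hyperplane j \<alpha> = {x. coord x j = \<alpha>}"

definition non_aligned :: "c0 measure \<Rightarrow> bool" where
  "non_aligned \<mu> \<longleftrightarrow> (\<forall>j \<alpha>. emeasure \<mu> (coord_hyperplane j \<alpha>) = 0)"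

definition fully_supported :: "'a::topological_space measure \<Rightarrow> bool" where
  "fully_supported \<mu> \<longleftrightarrow> (\<forall>U. open U \<and> U \<noteq> {} \<longrightarrow> emeasure \<mu> U > 0)"

text \<open>\<open>\<mu>\<close> is viewed as a measure on \<open>\<real>\<^sup>\<nat>\<close> by pushing it forward along the inclusion
  \<open>coord\<close> (measurable by \<open>measurable_coord\<close>).\<close>

definition product_type :: "c0 measure \<Rightarrow> bool" where
  "product_type \<mu> \<longleftrightarrow>
     (\<exists>\<nu> :: nat \<Rightarrow> real measure. (\<forall>n. borel_prob (\<nu> n)) \<and>
        distr \<mu> (\<Pi>\<^sub>M n\<in>UNIV. borel) coord = (\<Pi>\<^sub>M n\<in>UNIV. \<nu> n))"

subsection \<open>Graphs and the random graph LARG\<close>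

text \<open>A graph is a vertex set together with a set of edges, an edge being an unordered pair
  \<open>{u, v}\<close> of distinct vertices.\<close>

type_synonym 'a graph = "'a set \<times> 'a set set"

definition simple_graph :: "'a graph \<Rightarrow> bool" where
  "simple_graph G \<longleftrightarrow> (\<forall>e\<in>snd G. \<exists>u\<in>fst G. \<exists>v\<in>fst G. u \<noteq> v \<and> e = {u, v})"

definition graph_iso :: "'a graph \<Rightarrow> 'b graph \<Rightarrow> bool" where
  "graph_iso G H \<longleftrightarrow>
     (\<exists>f. bij_betw f (fst G) (fst H) \<and>
        (\<forall>u\<in>fst G. \<forall>v\<in>fst G. {u, v} \<in> snd G \<longleftrightarrow> {f u, f v} \<in> snd H))"

text \<open>\<open>LARG(V, \<delta>, p)\<close> is the random variable \<open>LARG_graph V \<delta>\<close> on the probability space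
  \<open>LARG_space V \<delta> p\<close>, which carries one independent \<open>p\<close>-coin per admissible pair.\<close>

definition LARG_pairs :: "'a::real_normed_vector set \<Rightarrow> real \<Rightarrow> 'a set set" where
  "LARG_pairs V \<delta> = {{u, v} |u v. u \<in> V \<and> v \<in> V \<and> u \<noteq> v \<and> norm (u - v) < \<delta>}"

definition LARG_space :: "'a::real_normed_vector set \<Rightarrow> real \<Rightarrow> real \<Rightarrow> ('a set \<Rightarrow> bool) measure" where
  "LARG_space V \<delta> p = (\<Pi>\<^sub>M e\<in>LARG_pairs V \<delta>. measure_pmf (bernoulli_pmf p))"

definition LARG_graph :: "'a::real_normed_vector set \<Rightarrow> real \<Rightarrow> ('a set \<Rightarrow> bool) \<Rightarrow> 'a graph" where
  "LARG_graph V \<delta> \<omega> = (V, {e \<in> LARG_pairs V \<delta>. \<omega> e})"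

text \<open>Every graph isomorphic to one on \<open>V\<close> has a copy with vertices in \<open>'a\<close>, so \<open>\<Gamma>\<close> may be
  taken over that type. The event of being isomorphic to \<open>\<Gamma>\<close> need not be measurable; the
  quantifier \<open>AE\<close> asks that it contain a measurable event of probability 1.\<close>

definition Rado :: "'a::real_normed_vector set \<Rightarrow> bool" where
  "Rado V \<longleftrightarrow> countable V \<and> closure V = UNIV \<and>
     (\<forall>\<delta> > 0. \<forall>p\<in>{0<..<1}. \<exists>\<Gamma> :: 'a graph. simple_graph \<Gamma> \<and>
        (AE \<omega> in LARG_space V \<delta> p. graph_iso (LARG_graph V \<delta> \<omega>) \<Gamma>))"

end

theory Submission imports Defs begin

text \<open>
  Two samples of \<open>LARG(V, \<delta>, p)\<close> are matched by a back-and-forth argument which preserves, besides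
  adjacency, the integers \<open>\<lfloor>(a\<^sub>n - b\<^sub>n) / \<delta>\<rfloor>\<close>; these decide whether \<open>\<parallel>a - b\<parallel> < \<delta>\<close>. Matching the order
  of the coordinates index by index would be impossible, since for each of the infinitely many \<open>n\<close> it
  has only a fixed chance to succeed. So the coordinates are permuted as well: a finite partial
  isomorphism carries a finite partial bijection of the coordinate indices, outside of which all points
  treated so far are small. When a new point is large in a new coordinate \<open>n\<close>, that coordinate is
  matched to an unused \<open>m\<close> in which the image points are ordered as the points are in \<open>n\<close>. Infinitely
  many such \<open>m\<close> exist by Borel--Cantelli: coordinates are independent as \<open>\<mu>\<close> is of product type, and
  by exchangeability all orders of \<open>k\<close> points are equally likely in each coordinate.

  The threshold \<open>\<delta>\<close> is chosen after \<open>V\<close>, so some \<open>(a\<^sub>n - b\<^sub>n) / \<delta>\<close> may be integers. Almost surely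
  this happens for at most one pair \<open>a, b\<close>; such a pair is at distance at least \<open>\<delta>\<close>, hence never an
  edge, and the back-and-forth starts from the identity on it.
\<close>

subsection \<open>Independence and infinite recurrence\<close>

text \<open>A weak form of the second Borel-Cantelli lemma: by continuity from above the limsup
  event has probability at least \<open>c\<close>, and the zero-one law raises this to 1.\<close>

lemma (in prob_space) AE_infinite_if_indep_events:
  fixes P :: "nat \<Rightarrow> 'a \<Rightarrow> bool"
  assumes indep: "indep_events (\<lambda>m. {x \<in> space M. P m x}) UNIV"
    and "0 < c" and ge: "\<And>m. c \<le> prob {x \<in> space M. P m x}"
  shows "AE x in M. infinite {m. P m x}"
proof -
  have [measurable]: "{x \<in> space M. P m x} \<in> events" for m
    using indep by (auto simp: indep_events_def)
  define A where "A n = (\<Union>m\<in>{n..}. {x \<in> space M. P m x})" for n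
  have "decseq A"
    by (fastforce simp: decseq_def A_def)
  moreover have "range A \<subseteq> events"
    by (auto simp: A_def)
  ultimately have "(\<lambda>n. prob (A n)) \<longlonglongrightarrow> prob (\<Inter>n. A n)"
    by (intro finite_Lim_measure_decseq)
  moreover have "c \<le> prob (A n)" for n
    by (rule order_trans[OF ge[of n]], rule finite_measure_mono) (auto simp: A_def)
  ultimately have "c \<le> prob (\<Inter>n. A n)"
    by (intro LIMSEQ_le_const) auto
  then have "prob (\<Inter>n. A n) = 1"
    using borel_0_1_law[OF indep] \<open>0 < c\<close> by (auto simp: A_def)
  then have "AE x in M. x \<in> (\<Inter>n. A n)"
    by (rule AE_prob_1)
  then show ?thesis
    by eventually_elim (auto simp: A_def infinite_nat_iff_unbounded_le)
qed

text \<open>A finite family of events is grouped by first index: the product measure factorises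
  between groups, independence of \<open>X\<close> within each. With \<open>X\<close> the coordinate
  maps, all the numbers \<open>coord (x i) n\<close> of the sample become independent.\<close>

lemma indep_vars_PiM_compose:
  assumes N: "prob_space N" and X: "prob_space.indep_vars N M' X K"
  shows "prob_space.indep_vars (PiM I (\<lambda>_. N)) (\<lambda>(i, k). M' k) (\<lambda>(i, k) \<omega>. X k (\<omega> i)) (I \<times> K)"
proof -
  interpret N: prob_space N by fact
  interpret product_prob_space "\<lambda>_. N" I ..
  have rv: "X k \<in> N \<rightarrow>\<^sub>M M' k" if "k \<in> K" for k
    using X that by (auto simp: N.indep_vars_def)
  have single: "P.prob {\<omega> \<in> space (PiM I (\<lambda>_. N)). X k (\<omega> i) \<in> B} = N.prob (X k -` B \<inter> space N)"
    if "i \<in> I" "k \<in> K" "B \<in> sets (M' k)" for i k B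
  proof -
    have "{\<omega> \<in> space (PiM I (\<lambda>_. N)). X k (\<omega> i) \<in> B}
        = {\<omega> \<in> space (PiM I (\<lambda>_. N)). \<omega> i \<in> X k -` B \<inter> space N}"
      using that by (auto simp: space_PiM)
    then show ?thesis
      using emeasure_PiM_Collect_single[of i "X k -` B \<inter> space N"] that rv
      by (auto simp: measure_def)
  qed
  show ?thesis
    unfolding P.indep_vars_def2
  proof (intro conjI ballI P.indep_setsI)
    fix ik assume "ik \<in> I \<times> K"
    then show "(case ik of (i, k) \<Rightarrow> \<lambda>\<omega>. X k (\<omega> i)) \<in> PiM I (\<lambda>_. N) \<rightarrow>\<^sub>M (case ik of (i, k) \<Rightarrow> M' k)"
      using rv by (auto intro!: measurable_compose[OF measurable_component_singleton])
    then show "{(case ik of (i, k) \<Rightarrow> \<lambda>\<omega>. X k (\<omega> i)) -` A \<inter> space (PiM I (\<lambda>_. N)) |A.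
        A \<in> sets (case ik of (i, k) \<Rightarrow> M' k)} \<subseteq> P.events"
      by (auto intro: measurable_sets)
  next
    fix A J assume J: "J \<noteq> {}" "J \<subseteq> I \<times> K" "finite J" and
      A: "\<forall>j\<in>J. A j \<in> {(case j of (i, k) \<Rightarrow> \<lambda>\<omega>. X k (\<omega> i)) -` B \<inter> space (PiM I (\<lambda>_. N)) |B.
        B \<in> sets (case j of (i, k) \<Rightarrow> M' k)}"
    define J2 where "J2 i = {k. (i, k) \<in> J}" for i
    have J_eq: "J = Sigma (fst ` J) J2"
      by (force simp: J2_def)
    have fin: "finite (J2 i)" for i
      using finite_imageI[OF \<open>finite J\<close>, of snd] by (rule rev_finite_subset) (force simp: J2_def)
    from A obtain B where B: "\<And>i k. (i, k) \<in> J \<Longrightarrow> B (i, k) \<in> sets (M' k)"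
      and A_eq: "\<And>i k. (i, k) \<in> J \<Longrightarrow> A (i, k) = {\<omega> \<in> space (PiM I (\<lambda>_. N)). X k (\<omega> i) \<in> B (i, k)}"
    proof -
      have "\<forall>j\<in>J. \<exists>B. B \<in> sets (M' (snd j)) \<and> A j = {\<omega> \<in> space (PiM I (\<lambda>_. N)). X (snd j) (\<omega> (fst j)) \<in> B}"
        using A by (fastforce split: prod.splits)
      then obtain B where "\<forall>j\<in>J. B j \<in> sets (M' (snd j)) \<and>
          A j = {\<omega> \<in> space (PiM I (\<lambda>_. N)). X (snd j) (\<omega> (fst j)) \<in> B j}"
        by (rule bchoice[THEN exE]) blast
      then show ?thesis
        by (intro that[of B]) auto
    qed
    \<comment> \<open>\<open>C i\<close> bundles all constraints on the \<open>i\<close>-th factor,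
      which turns the whole intersection into a cylinder.\<close>
    define C where "C i = (\<Inter>k\<in>J2 i. X k -` B (i, k) \<inter> space N)" for i
    have ne: "J2 i \<noteq> {}" if "i \<in> fst ` J" for i
      using that by (auto simp: J2_def)
    have C: "C i \<in> sets N" if "i \<in> fst ` J" for i
      unfolding C_def using that J B rv fin ne
      by (intro sets.finite_INT) (auto simp: J2_def intro!: measurable_sets)
    have "(\<Inter>j\<in>J. A j) = {\<omega> \<in> space (PiM I (\<lambda>_. N)). \<forall>i\<in>fst ` J. \<omega> i \<in> C i}"
      using J by (force simp: A_eq C_def J2_def space_PiM)
    moreover have "fst ` J \<subseteq> I"
      using J by auto
    ultimately have "P.prob (\<Inter>j\<in>J. A j) = (\<Prod>i\<in>fst ` J. N.prob (C i))"
      using emeasure_PiM_Collect[of "fst ` J" C] J C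
      by (auto simp: P.emeasure_eq_measure N.emeasure_eq_measure prod_ennreal prod_nonneg)
    also have "\<dots> = (\<Prod>i\<in>fst ` J. \<Prod>k\<in>J2 i. N.prob (X k -` B (i, k) \<inter> space N))"
    proof (intro prod.cong refl)
      fix i assume i: "i \<in> fst ` J"
      show "N.prob (C i) = (\<Prod>k\<in>J2 i. N.prob (X k -` B (i, k) \<inter> space N))"
        unfolding C_def using X i J fin ne B unfolding N.indep_vars_def2
        by (intro N.indep_setsD[of _ K]) (auto simp: J2_def)
    qed
    also have "\<dots> = (\<Prod>i\<in>fst ` J. \<Prod>k\<in>J2 i. P.prob (A (i, k)))"
    proof (intro prod.cong refl)
      fix i k assume "k \<in> J2 i"
      then show "N.prob (X k -` B (i, k) \<inter> space N) = P.prob (A (i, k))"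
        using J B by (subst single[symmetric]) (auto simp: J2_def A_eq)
    qed
    also have "\<dots> = (\<Prod>j\<in>J. P.prob (A j))"
      using J fin by (subst J_eq, subst prod.Sigma) auto
    finally show "P.prob (\<Inter>j\<in>J. A j) = (\<Prod>j\<in>J. P.prob (A j))" .
  qed
qed

text \<open>The joint law of the projections is the law of the identity, which is the product
  measure. The characterisation by joint laws asks for a nonempty index set, hence the case
  split.\<close>

lemma indep_vars_PiM_components:
  assumes "\<And>i. i \<in> I \<Longrightarrow> prob_space (M i)"
  shows "prob_space.indep_vars (PiM I M) M (\<lambda>i \<omega>. \<omega> i) I"
proof (cases "I = {}")
  case True
  interpret prob_space "PiM I M" using assms by (intro prob_space_PiM)
  show ?thesis unfolding indep_vars_def indep_sets_def by (auto simp: True)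
next
  case False
  interpret prob_space "PiM I M" using assms by (intro prob_space_PiM)
  have "distr (PiM I M) (PiM I M) (\<lambda>\<omega>. \<lambda>i\<in>I. \<omega> i) = distr (PiM I M) (PiM I M) (\<lambda>\<omega>. \<omega>)"
    by (intro distr_cong) (auto simp: space_PiM PiE_def extensional_restrict)
  also have "\<dots> = (\<Pi>\<^sub>M i\<in>I. distr (PiM I M) (M i) (\<lambda>\<omega>. \<omega> i))"
    using assms by (simp add: distr_PiM_component cong: PiM_cong)
  finally show ?thesis
    using False by (subst indep_vars_iff_distr_eq_PiM') auto
qed

subsection \<open>Almost sure properties of the sample\<close>

lemma borel_measurable_coord [measurable (raw)]:
  "f \<in> M \<rightarrow>\<^sub>M borel \<Longrightarrow> (\<lambda>x. coord (f x) n) \<in> borel_measurable M"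
  by (rule measurable_compose[of f])
     (auto intro: borel_measurable_continuous_onI continuous_on_coord)

text \<open>\<open>product_type\<close> only provides some factors \<open>\<nu>\<close>. Projecting
  to one coordinate identifies \<open>\<nu> n\<close> as its law, and the product formula then
  expresses independence.\<close>

lemma indep_vars_coord:
  assumes "borel_prob \<mu>" "product_type \<mu>"
  shows "prob_space.indep_vars \<mu> (\<lambda>_. borel) (\<lambda>n x. coord x n) UNIV"
proof -
  interpret prob_space \<mu> using assms by (simp add: borel_prob_def)
  have [measurable_cong]: "sets \<mu> = sets borel" using assms by (simp add: borel_prob_def)
  obtain \<nu> :: "nat \<Rightarrow> real measure" where \<nu>: "\<And>n. borel_prob (\<nu> n)"
    and eq: "distr \<mu> (\<Pi>\<^sub>M n\<in>UNIV. borel) coord = (\<Pi>\<^sub>M n\<in>UNIV. \<nu> n)"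
    using assms by (auto simp: product_type_def)
  have m: "coord \<in> \<mu> \<rightarrow>\<^sub>M (\<Pi>\<^sub>M n\<in>UNIV. borel)"
    using measurable_coord by measurable
  have "distr \<mu> borel (\<lambda>x. coord x n) = \<nu> n" for n
  proof -
    have "distr \<mu> borel (\<lambda>x. coord x n) = distr (distr \<mu> (\<Pi>\<^sub>M n\<in>UNIV. borel) coord) borel (\<lambda>f. f n)"
      using m by (subst distr_distr) (auto simp: comp_def)
    also have "\<dots> = distr (\<Pi>\<^sub>M n\<in>UNIV. \<nu> n) (\<nu> n) (\<lambda>f. f n)"
      using \<nu> by (intro distr_cong eq) (auto simp: borel_prob_def)
    also have "\<dots> = \<nu> n"
      using \<nu> by (intro distr_PiM_component) (auto simp: borel_prob_def)
    finally show ?thesis .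
  qed
  then show ?thesis
    by (subst indep_vars_iff_distr_eq_PiM) (auto simp: restrict_UNIV eq)
qed

text \<open>A countable pi-base: balls around finitely supported rational sequences, which are dense
  because tails of null sequences are small. It reduces almost sure statements about all nonempty
  open sets to countably many.\<close>

lemma countable_open_base_c0:
  obtains \<B> :: "c0 set set" where "countable \<B>" "\<And>B. B \<in> \<B> \<Longrightarrow> open B \<and> B \<noteq> {}"
    "\<And>U. open U \<Longrightarrow> U \<noteq> {} \<Longrightarrow> \<exists>B\<in>\<B>. B \<subseteq> U"
proof
  define c where "c l = Abs_c0 (\<lambda>n. if n < length l then l ! n else 0)" for l :: "real list"
  have coord_c: "coord (c l) n = (if n < length l then l ! n else 0)" for l n
  proof -
    have "(\<lambda>n. if n < length l then l ! n else 0) \<longlonglongrightarrow> 0"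
      by (rule tendsto_eventually) (auto intro!: eventually_sequentiallyI[of "length l"])
    then show ?thesis by (simp add: c_def Abs_c0_inverse)
  qed
  define \<B> where "\<B> = (\<lambda>(l, k). ball (c l) (1 / real (Suc k))) ` (lists \<rat> \<times> UNIV)"
  show "countable \<B>"
    unfolding \<B>_def by (intro countable_image countable_SIGMA countable_lists countable_rat) auto
  show "open B \<and> B \<noteq> {}" if "B \<in> \<B>" for B
    using that by (auto simp: \<B>_def)
  show "\<exists>B\<in>\<B>. B \<subseteq> U" if "open U" "U \<noteq> {}" for U
  proof -
    from that obtain x e where e: "0 < e" "ball x e \<subseteq> U"
      by (meson ex_in_conv open_contains_ball)
    obtain k where k: "2 / e < real k" using reals_Archimedean2 by blast
    \<comment> \<open>Once \<open>2 * r \<le> e\<close>, a ball of radius \<open>r\<close> whose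
      centre is within \<open>r / 2\<close> of \<open>x\<close> lies in
      \<open>ball x e\<close>.\<close>
    define r where "r = 1 / real (Suc k)"
    have r: "0 < r" "2 * r \<le> e"
      using k e by (auto simp: r_def field_simps)
    obtain N where N: "\<And>n. n \<ge> N \<Longrightarrow> \<bar>coord x n\<bar> < r / 2"
      using LIMSEQ_D[OF coord_tendsto_0, of "r / 2" x] r by auto
    have "\<exists>q\<in>\<rat>. \<bar>coord x n - q\<bar> < r / 2" for n
      using Rats_dense_in_real[of "coord x n" "coord x n + r / 2"] r by force
    then obtain q where q: "\<And>n. q n \<in> \<rat>" "\<And>n. \<bar>coord x n - q n\<bar> < r / 2"
      by metis
    define l where "l = map q [0..<N]"
    have "norm (c l - x) \<le> r / 2"
    proof (rule norm_c0_leI)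
      fix n
      show "\<bar>coord (c l - x) n\<bar> \<le> r / 2"
        using q(2)[of n] N[of n] by (cases "n < N") (auto simp: coord_c l_def abs_minus_commute)
    qed
    then have "dist x (c l) \<le> r / 2"
      by (simp add: dist_norm norm_minus_commute)
    then have "ball (c l) r \<subseteq> ball x e"
      using r by (intro subsetI) (simp, smt (verit) dist_triangle field_sum_of_halves)
    moreover have "ball (c l) r \<in> \<B>"
      using q(1) by (auto simp: \<B>_def r_def l_def intro!: image_eqI[of _ _ "(l, k)"])
    ultimately show ?thesis using e by blast
  qed
qed

text \<open>Visits to a fixed set of the pi-base are independent with a common positive probability.
  Infinitely many visits, rather than one, allow later choices to avoid finitely many
  indices.\<close>

lemma AE_infinite_in_open:
  assumes "borel_prob \<mu>" and "fully_supported \<mu>"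
  shows "AE x in (\<Pi>\<^sub>M i\<in>(UNIV :: nat set). \<mu>). \<forall>U::c0 set. open U \<and> U \<noteq> {} \<longrightarrow> infinite {i. x i \<in> U}"
proof -
  interpret \<mu>: prob_space \<mu> using assms by (simp add: borel_prob_def)
  interpret product_prob_space "\<lambda>_. \<mu>" "UNIV :: nat set" ..
  have [measurable_cong]: "sets \<mu> = sets borel" using assms by (simp add: borel_prob_def)
  obtain \<B> :: "c0 set set" where \<B>: "countable \<B>" "\<And>B. B \<in> \<B> \<Longrightarrow> open B \<and> B \<noteq> {}"
    "\<And>U. open U \<Longrightarrow> U \<noteq> {} \<Longrightarrow> \<exists>B\<in>\<B>. B \<subseteq> U"
    using countable_open_base_c0 by blast
  have "AE x in PiM (UNIV :: nat set) (\<lambda>_. \<mu>). infinite {i. x i \<in> B}" if "B \<in> \<B>" for B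
  proof (rule P.AE_infinite_if_indep_events)
    have B[measurable]: "B \<in> sets borel" using that \<B> by auto
    show "P.indep_events (\<lambda>m. {x \<in> space (PiM UNIV (\<lambda>_. \<mu>)). x m \<in> B}) UNIV"
      by (rule P.indep_eventsI_indep_vars[OF indep_vars_PiM_components]) (auto simp: \<mu>.prob_space_axioms)
    show "0 < \<mu>.prob B"
      using that \<B> assms by (auto simp: fully_supported_def \<mu>.emeasure_eq_measure)
    show "\<mu>.prob B \<le> P.prob {x \<in> space (PiM UNIV (\<lambda>_. \<mu>)). x m \<in> B}" for m
      using emeasure_PiM_Collect_single[of m B] B
      by (auto simp: measure_def \<open>sets \<mu> = sets borel\<close>)
  qed
  then have "AE x in PiM (UNIV :: nat set) (\<lambda>_. \<mu>). \<forall>B\<in>\<B>. infinite {i. x i \<in> B}"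
    using \<B> by (intro AE_ball_countable[THEN iffD2]) auto
  then show ?thesis
  proof eventually_elim
    case (elim x)
    show ?case
    proof (intro allI impI)
      fix U :: "c0 set" assume "open U \<and> U \<noteq> {}"
      then obtain B where "B \<in> \<B>" "B \<subseteq> U" using \<B> by blast
      then show "infinite {i. x i \<in> U}"
        using elim infinite_super[of "{i. x i \<in> B}" "{i. x i \<in> U}"] by auto
    qed
  qed
qed

text \<open>Fubini: with all points except \<open>x i\<close> fixed, the right-hand side is a
  constant, and \<open>coord (x i) n\<close> has no atoms. The factor \<open>q\<close> will be a
  quotient of two integers; it serves to eliminate the threshold, which is not yet known and ranges
  over an uncountable set.\<close>

lemma AE_no_coincidence:
  assumes "borel_prob \<mu>" and "non_aligned \<mu>"
  shows "AE x in (\<Pi>\<^sub>M i\<in>(UNIV :: nat set). \<mu>). \<forall>i j k l m n. \<forall>q\<in>\<rat>. i \<notin> {j, k, l} \<longrightarrow>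
    coord (x i) n \<noteq> coord (x j) n + q * (coord (x k) m - coord (x l) m)"
proof -
  interpret \<mu>: prob_space \<mu> using assms by (simp add: borel_prob_def)
  have [measurable_cong]: "sets \<mu> = sets borel" using assms by (simp add: borel_prob_def)
  have "AE x in PiM UNIV (\<lambda>_. \<mu>). coord (x i) n \<noteq> coord (x j) n + q * (coord (x k) m - coord (x l) m)"
    if i: "i \<notin> {j, k, l}" for i j k l m n :: nat and q :: real
  proof -
    define J where "J = UNIV - {i}"
    let ?P = "PiM J (\<lambda>_. \<mu>)"
    let ?g = "\<lambda>X. coord (X j) n + q * (coord (X k) m - coord (X l) m)"
    have J: "j \<in> J" "k \<in> J" "l \<in> J" "J \<noteq> {}" using i by (auto simp: J_def)
    interpret J: prob_space ?P by (intro prob_space_PiM \<mu>.prob_space_axioms)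
    interpret pair_sigma_finite \<mu> ?P ..
    have [measurable]: "?g \<in> borel_measurable ?P" using J by measurable
    have "AE y in \<mu>. coord y n \<noteq> c" for c
      using assms by (intro AE_I[of _ _ "coord_hyperplane n c"])
        (auto simp: coord_hyperplane_def non_aligned_def)
    then have "AE X in ?P. AE y in \<mu>. coord y n \<noteq> ?g X" by simp
    \<comment> \<open>The exceptional set is null for each fixed \<open>X\<close>, whereas
      \<open>AE_pair_measure\<close> expects the \<open>\<mu>\<close>-variable outside.\<close>
    then have "AE y in \<mu>. AE X in ?P. coord y n \<noteq> ?g X"
      by (subst AE_commute) auto
    then have "AE z in \<mu> \<Otimes>\<^sub>M ?P. coord (fst z) n \<noteq> ?g (snd z)"
      by (intro AE_pair_measure) auto
    then have ae: "AE z in \<mu> \<Otimes>\<^sub>M ?P. coord (((snd z)(i := fst z)) i) n \<noteq> ?g ((snd z)(i := fst z))"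
      using i by simp
    have eq: "distr (\<mu> \<Otimes>\<^sub>M ?P) (PiM (insert i J) (\<lambda>_. \<mu>)) (\<lambda>(y, X). X(i := y)) = PiM (insert i J) (\<lambda>_. \<mu>)"
      using \<mu>.prob_space_axioms J by (intro distr_pair_PiM_eq_PiM) auto
    have ins: "insert i J = UNIV" by (auto simp: J_def)
    have "AE x in distr (\<mu> \<Otimes>\<^sub>M ?P) (PiM (insert i J) (\<lambda>_. \<mu>)) (\<lambda>(y, X). X(i := y)). coord (x i) n \<noteq> ?g x"
    proof (subst AE_distr_iff)
      show "(\<lambda>(y, X). X(i := y)) \<in> \<mu> \<Otimes>\<^sub>M ?P \<rightarrow>\<^sub>M PiM (insert i J) (\<lambda>_. \<mu>)"
        unfolding case_prod_beta by (intro measurable_fun_upd[of _ J]) auto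
      show "{x \<in> space (PiM (insert i J) (\<lambda>_. \<mu>)). coord (x i) n \<noteq> ?g x} \<in> sets (PiM (insert i J) (\<lambda>_. \<mu>))"
        unfolding ins by (intro sets.sets_Collect_neg borel_measurable_eq) measurable
    qed (use ae in \<open>simp add: case_prod_beta\<close>)
    then show ?thesis
      unfolding eq unfolding ins
      by (elim eventually_mono)
  qed
  then show ?thesis
    by (intro AE_all_countable[THEN iffD2] AE_ball_countable[OF countable_rat, THEN iffD2] allI ballI AE_impI)
qed

lemma sets_Collect_const_imp:
  "(Q \<Longrightarrow> {x \<in> space M. P x} \<in> sets M) \<Longrightarrow> {x \<in> space M. Q \<longrightarrow> P x} \<in> sets M"
  by (cases Q) simp_all

text \<open>In each coordinate finitely many points are almost surely strictly ordered in some way,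
  and exchangeability makes all orders equally likely. A given order thus has a probability bounded
  below uniformly in \<open>n\<close>, although the laws of the coordinates may differ, and
  Borel-Cantelli applies.\<close>

lemma AE_infinite_coord_sorted:
  assumes "borel_prob \<mu>" and "non_aligned \<mu>" and "product_type \<mu>"
  shows "AE x in (\<Pi>\<^sub>M i\<in>(UNIV :: nat set). \<mu>). \<forall>is. distinct is \<longrightarrow>
    infinite {n. sorted_wrt (<) (map (\<lambda>i. coord (x i) n) is)}"
proof -
  interpret \<mu>: prob_space \<mu> using assms by (simp add: borel_prob_def)
  interpret product_prob_space "\<lambda>_. \<mu>" "UNIV :: nat set" ..
  have [measurable_cong]: "sets \<mu> = sets borel" using assms by (simp add: borel_prob_def)
  let ?P = "PiM (UNIV :: nat set) (\<lambda>_. \<mu>)"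
  have "AE x in ?P. infinite {n. \<forall>a b. a < b \<and> b < length is \<longrightarrow> coord (x (is ! a)) n < coord (x (is ! b)) n}"
    if "distinct is" for "is"
  proof (rule P.AE_infinite_if_indep_events)
    \<comment> \<open>The blocks \<open>K n\<close> are disjoint, so events about the
      \<open>n\<close>-th coordinates alone are independent for different \<open>n\<close>.\<close>
    define K where "K n = set is \<times> {n}" for n :: nat
    have "P.indep_vars (\<lambda>n. PiM (K n) (\<lambda>(i, k). borel))
        (\<lambda>n \<omega>. \<lambda>ik\<in>K n. (case ik of (i, n) \<Rightarrow> \<lambda>\<omega>. coord (\<omega> i) n) \<omega>) UNIV"
      by (rule P.indep_vars_restrict[OF indep_vars_PiM_compose[OF \<mu>.prob_space_axioms indep_vars_coord]])
        (auto simp: assms K_def disjoint_family_on_def)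
    then have "P.indep_events (\<lambda>n. {x \<in> space ?P. \<forall>a b. a < b \<and> b < length is \<longrightarrow>
      (\<lambda>ik\<in>K n. (case ik of (i, n) \<Rightarrow> \<lambda>\<omega>. coord (\<omega> i) n) x) (is ! a, n)
      < (\<lambda>ik\<in>K n. (case ik of (i, n) \<Rightarrow> \<lambda>\<omega>. coord (\<omega> i) n) x) (is ! b, n)}) UNIV"
    proof (rule P.indep_eventsI_indep_vars)
      fix n
      let ?M = "PiM (K n) (\<lambda>(i, k). borel) :: (nat \<times> nat \<Rightarrow> real) measure"
      have meas: "(\<lambda>f. f (is ! a, n)) \<in> borel_measurable ?M" if "a < length is" for a
        using that by (intro measurable_component_singleton[of "(is ! a, n)" "K n" "\<lambda>(i, k). borel", simplified])
          (auto simp: K_def)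
      show "{f \<in> space ?M. \<forall>a b. a < b \<and> b < length is \<longrightarrow> f (is ! a, n) < f (is ! b, n)} \<in> sets ?M"
        using meas by (intro sets.sets_Collect_countable_All sets_Collect_const_imp borel_measurable_less) auto
    qed
    also have "(\<lambda>n. {x \<in> space ?P. \<forall>a b. a < b \<and> b < length is \<longrightarrow>
        (\<lambda>ik\<in>K n. (case ik of (i, n) \<Rightarrow> \<lambda>\<omega>. coord (\<omega> i) n) x) (is ! a, n)
        < (\<lambda>ik\<in>K n. (case ik of (i, n) \<Rightarrow> \<lambda>\<omega>. coord (\<omega> i) n) x) (is ! b, n)})
      = (\<lambda>n. {x \<in> space ?P. \<forall>a b. a < b \<and> b < length is \<longrightarrow>
        coord (x (is ! a)) n < coord (x (is ! b)) n})"
      by (intro ext Collect_cong conj_cong refl all_cong1 imp_cong) (auto simp: K_def)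
    finally show "P.indep_events (\<lambda>n. {x \<in> space ?P. \<forall>a b. a < b \<and> b < length is \<longrightarrow>
        coord (x (is ! a)) n < coord (x (is ! b)) n}) UNIV" .
  next
    define E where "E is n = {x \<in> space ?P. \<forall>a b. a < b \<and> b < length is \<longrightarrow>
        coord (x (is ! a)) n < coord (x (is ! b)) n}" for "is" and n
    define L where "L = {js. set js = set is \<and> distinct js}"
    have "finite L"
      by (rule finite_subset[OF _ finite_subset_distinct[of "set is"]]) (auto simp: L_def)
    have "is \<in> L" using that by (simp add: L_def)
    have E [measurable]: "E js n \<in> sets ?P" for js n
      unfolding E_def by measurable
    \<comment> \<open>Any \<open>length is\<close> distinct sample points have the same joint law,
      the finite power \<open>?Q\<close>.\<close>
    have same: "P.prob (E js n) = P.prob (E is n)" if "js \<in> L" for js n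
    proof -
      have len: "length js = length is"
        using that \<open>distinct is\<close> by (metis (mono_tags, lifting) L_def distinct_card mem_Collect_eq)
      let ?Q = "PiM {..<length is} (\<lambda>_. \<mu>)"
      let ?F = "{g \<in> space ?Q. \<forall>a b. a < b \<and> b < length is \<longrightarrow> coord (g a) n < coord (g b) n}"
      have F: "?F \<in> sets ?Q"
        by (intro sets.sets_Collect_countable_All sets_Collect_const_imp borel_measurable_less
            borel_measurable_coord) (auto simp: measurable_cong_sets[OF refl \<open>sets \<mu> = sets borel\<close>, symmetric])
      have "P.prob (E ks n) = measure ?Q ?F" if "distinct ks" "length ks = length is" for ks
      proof -
        have eq: "distr ?P ?Q (\<lambda>\<omega>. \<lambda>n\<in>{..<length is}. \<omega> (ks ! n)) = ?Q"
          using that by (intro distr_PiM_reindex) (auto simp: inj_on_nth \<mu>.prob_space_axioms)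
        have "measure ?Q ?F = P.prob ((\<lambda>\<omega>. \<lambda>n\<in>{..<length is}. \<omega> (ks ! n)) -` ?F \<inter> space ?P)"
          using F by (subst eq[symmetric], subst measure_distr) (auto intro!: measurable_restrict)
        also have "(\<lambda>\<omega>. \<lambda>n\<in>{..<length is}. \<omega> (ks ! n)) -` ?F \<inter> space ?P = E ks n"
          using that by (auto simp: E_def space_PiM)
        finally show ?thesis by simp
      qed
      then show ?thesis
        using len \<open>js \<in> L\<close> \<open>distinct is\<close> by (simp add: L_def)
    qed
    fix n
    have "AE x in ?P. x \<in> (\<Union>js\<in>L. E js n)"
      using AE_no_coincidence[OF assms(1,2)] AE_space
    proof eventually_elim
      case (elim x)
      \<comment> \<open>The instance \<open>q = 0\<close> excludes equal coordinates, so the sorted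
        list is strictly sorted.\<close>
      have ne: "coord (x i) n \<noteq> coord (x j) n" if "i \<noteq> j" for i j
        using bspec[OF elim(1)[THEN spec[of _ i], THEN spec[of _ j], THEN spec[of _ j], THEN spec[of _ j],
              THEN spec[of _ n], THEN spec[of _ n]], of 0] that by simp
      define js where "js = sort_key (\<lambda>i. coord (x i) n) is"
      have "js \<in> L" using \<open>distinct is\<close> by (simp add: L_def js_def)
      moreover have "x \<in> E js n"
      proof -
        have "sorted (map (\<lambda>i. coord (x i) n) js)" by (simp add: js_def)
        moreover have "distinct (map (\<lambda>i. coord (x i) n) js)"
          using \<open>js \<in> L\<close> ne by (auto simp: distinct_map L_def inj_on_def)
        ultimately have "sorted_wrt (<) (map (\<lambda>i. coord (x i) n) js)"
          by (simp add: strict_sorted_iff)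
        then show ?thesis
          using elim(2) by (auto simp: E_def sorted_wrt_iff_nth_less)
      qed
      ultimately show ?case by blast
    qed
    \<comment> \<open>The union bound over the \<open>card L\<close> equally likely orders gives the
      lower bound \<open>1 / card L\<close>.\<close>
    then have "1 = P.prob (\<Union>js\<in>L. E js n)"
      using \<open>finite L\<close> by (subst (asm) P.prob_eq_1[symmetric]) auto
    also have "\<dots> \<le> (\<Sum>js\<in>L. P.prob (E js n))"
      using \<open>finite L\<close> by (intro P.finite_measure_subadditive_finite) auto
    also have "\<dots> = card L * P.prob (E is n)"
      by (simp add: same)
    finally show "1 / card L \<le> P.prob {x \<in> space ?P. \<forall>a b. a < b \<and> b < length is \<longrightarrow>
        coord (x (is ! a)) n < coord (x (is ! b)) n}"
      using \<open>finite L\<close> \<open>is \<in> L\<close> unfolding E_def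
      by (subst pos_divide_le_eq) (auto simp: card_gt_0_iff mult.commute)
    show "0 < 1 / real (card L)"
      using \<open>finite L\<close> \<open>is \<in> L\<close> by (auto simp: card_gt_0_iff)
  qed
  then have "AE x in ?P. \<forall>is. distinct is \<longrightarrow> infinite {n. \<forall>a b. a < b \<and> b < length is \<longrightarrow>
      coord (x (is ! a)) n < coord (x (is ! b)) n}"
    by (intro AE_all_countable[THEN iffD2] allI AE_impI)
  moreover have "{n. sorted_wrt (<) (map (\<lambda>i. coord (x i) n) is)}
      = {n. \<forall>a b. a < b \<and> b < length is \<longrightarrow> coord (x (is ! a)) n < coord (x (is ! b)) n}"
    for x :: "nat \<Rightarrow> c0" and "is"
    by (auto simp: sorted_wrt_iff_nth_less)
  ultimately show ?thesis by simp
qed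

subsection \<open>The extension property of the random graph\<close>

text \<open>Different candidates in \<open>C\<close> use disjoint finite sets of coins, so their
  adjacency patterns to \<open>S \<union> T\<close> are independent, and the desired pattern has
  probability bounded below.\<close>

lemma AE_LARG_infinite_extension:
  assumes p: "p \<in> {0<..<1}" and "infinite C" "finite S" "finite T" "S \<inter> T = {}" "C \<inter> (S \<union> T) = {}"
    and pairs: "\<And>v b. v \<in> C \<Longrightarrow> b \<in> S \<union> T \<Longrightarrow> {v, b} \<in> LARG_pairs V \<delta>"
  shows "AE \<omega> in LARG_space V \<delta> p. infinite {v \<in> C. (\<forall>s\<in>S. \<omega> {v, s}) \<and> (\<forall>t\<in>T. \<not> \<omega> {v, t})}"
proof -
  let ?B = "measure_pmf (bernoulli_pmf p)"
  interpret product_prob_space "\<lambda>_. ?B" "LARG_pairs V \<delta>" ..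
  obtain c :: "nat \<Rightarrow> 'a" where c: "inj c" "range c \<subseteq> C"
    using infinite_countable_subset[OF \<open>infinite C\<close>] by blast
  define K where "K k = (\<lambda>b. {c k, b}) ` (S \<union> T)" for k
  define Y where "Y k = (\<lambda>b. {c k, b}) ` S" for k
  have K_sub: "K k \<subseteq> LARG_pairs V \<delta>" for k
    using c pairs by (auto simp: K_def)
  have fin: "finite (K k)" for k
    using assms by (simp add: K_def)
  \<comment> \<open>As \<open>C\<close> avoids \<open>S \<union> T\<close>, a pair
    \<open>{c k, b}\<close> determines \<open>k\<close>.\<close>
  have disj: "disjoint_family_on K UNIV"
    using c assms(6) by (fastforce simp: disjoint_family_on_def K_def doubleton_eq_iff inj_eq)
  have "AE \<omega> in LARG_space V \<delta> p. infinite {k. \<forall>e\<in>K k. \<omega> e = (e \<in> Y k)}"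
    unfolding LARG_space_def
  proof (rule P.AE_infinite_if_indep_events)
    have "P.indep_vars (\<lambda>k. PiM (K k) (\<lambda>_. ?B)) (\<lambda>k \<omega>. \<lambda>e\<in>K k. \<omega> e) UNIV"
      using K_sub disj
      by (intro P.indep_vars_restrict[OF indep_vars_PiM_components])
        (auto simp: measure_pmf.prob_space_axioms)
    then have "P.indep_events (\<lambda>k. {\<omega> \<in> space (PiM (LARG_pairs V \<delta>) (\<lambda>_. ?B)).
        \<forall>e\<in>K k. (\<lambda>e\<in>K k. \<omega> e) e = (e \<in> Y k)}) UNIV"
    proof (rule P.indep_eventsI_indep_vars)
      show "{\<omega> \<in> space (PiM (K k) (\<lambda>_. ?B)). \<forall>e\<in>K k. \<omega> e = (e \<in> Y k)} \<in> sets (PiM (K k) (\<lambda>_. ?B))" for k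
        using fin by (intro sets.sets_Collect_finite_All) auto
    qed
    then show "P.indep_events (\<lambda>k. {\<omega> \<in> space (PiM (LARG_pairs V \<delta>) (\<lambda>_. ?B)). \<forall>e\<in>K k. \<omega> e = (e \<in> Y k)}) UNIV"
      by simp
    \<comment> \<open>\<open>m\<close> bounds the probability of either outcome of a coin from
      below.\<close>
    define m where "m = min p (1 - p)"
    have m: "0 < m" "m \<le> 1" using p by (auto simp: m_def)
    have m_le: "m \<le> pmf (bernoulli_pmf p) b" for b
      using p by (cases b) (auto simp: m_def)
    show "0 < m ^ card (S \<union> T)" using m by simp
    show "m ^ card (S \<union> T) \<le> P.prob {\<omega> \<in> space (PiM (LARG_pairs V \<delta>) (\<lambda>_. ?B)). \<forall>e\<in>K k. \<omega> e = (e \<in> Y k)}" for k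
    proof -
      have "m ^ card (S \<union> T) \<le> m ^ card (K k)"
        using m assms by (intro power_decreasing) (auto simp: K_def card_image_le)
      also have "\<dots> = (\<Prod>e\<in>K k. m)" by simp
      also have "\<dots> \<le> (\<Prod>e\<in>K k. measure ?B {e \<in> Y k})"
        using m m_le by (intro prod_mono conjI) (simp_all add: measure_pmf_single)
      also have "\<dots> = P.prob {\<omega> \<in> space (PiM (LARG_pairs V \<delta>) (\<lambda>_. ?B)). \<forall>e\<in>K k. \<omega> e \<in> {e \<in> Y k}}"
        using emeasure_PiM_Collect[of "K k" "\<lambda>e. {e \<in> Y k}"] K_sub fin
        by (simp add: P.emeasure_eq_measure measure_pmf.emeasure_eq_measure prod_ennreal prod_nonneg)
      finally show ?thesis by simp
    qed
  qed
  then show ?thesis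
  proof eventually_elim
    case (elim \<omega>)
    have "infinite (c ` {k. \<forall>e\<in>K k. \<omega> e = (e \<in> Y k)})"
      using elim c by (simp add: finite_image_iff inj_on_subset[OF c(1)])
    moreover have "c ` {k. \<forall>e\<in>K k. \<omega> e = (e \<in> Y k)} \<subseteq> {v \<in> C. (\<forall>s\<in>S. \<omega> {v, s}) \<and> (\<forall>t\<in>T. \<not> \<omega> {v, t})}"
    proof safe
      fix k assume k: "\<forall>e\<in>K k. \<omega> e = (e \<in> Y k)"
      show "c k \<in> C" using c by blast
      show "\<omega> {c k, s}" if "s \<in> S" for s
        using that k by (auto simp: K_def Y_def)
      show False if "t \<in> T" "\<omega> {c k, t}" for t
        using that k assms(5) by (fastforce simp: K_def Y_def doubleton_eq_iff)
    qed
    ultimately show ?case using infinite_super by blast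
  qed
qed

subsection \<open>Back and forth\<close>

text \<open>All but finitely many coordinates are below \<open>d / 2\<close>, so the supremum is at
  most a maximum of finitely many numbers below \<open>d\<close>. For general bounded sequences
  strictness could be lost.\<close>

lemma norm_c0_less_iff:
  fixes y :: c0
  assumes "0 < d"
  shows "norm y < d \<longleftrightarrow> (\<forall>n. \<bar>coord y n\<bar> < d)"
proof
  assume "norm y < d"
  then show "\<forall>n. \<bar>coord y n\<bar> < d"
    using abs_coord_le_norm le_less_trans by blast
next
  assume lt: "\<forall>n. \<bar>coord y n\<bar> < d"
  obtain N where N: "\<And>n. n \<ge> N \<Longrightarrow> \<bar>coord y n\<bar> < d / 2"
    using LIMSEQ_D[OF coord_tendsto_0, of "d / 2" y] assms by auto
  define K where "K = Max (insert (d / 2) ((\<lambda>n. \<bar>coord y n\<bar>) ` {..<N}))"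
  have "norm y \<le> K"
  proof (rule norm_c0_leI)
    fix n
    show "\<bar>coord y n\<bar> \<le> K"
    proof (cases "n < N")
      case False
      then have "\<bar>coord y n\<bar> \<le> d / 2" using N[of n] by simp
      also have "\<dots> \<le> K" unfolding K_def by (rule Max_ge) auto
      finally show ?thesis .
    qed (simp add: K_def)
  qed
  also have "K < d"
    using lt assms by (auto simp: K_def)
  finally show "norm y < d" .
qed

lemma floor_of_abs_less_1:
  fixes r :: real
  assumes "\<bar>r\<bar> < 1"
  shows "\<lfloor>r\<rfloor> = (if 0 \<le> r then 0 else -1)"
  using assms by (intro floor_unique) auto

text \<open>Non-integrality rules out \<open>r = -1\<close>, whose floor is -1 although its absolute
  value is 1.\<close>

lemma abs_less_1_iff_floor:
  fixes r :: real
  assumes "r \<notin> \<int>"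
  shows "\<bar>r\<bar> < 1 \<longleftrightarrow> \<lfloor>r\<rfloor> \<in> {-1, 0}"
proof
  assume "\<bar>r\<bar> < 1"
  then show "\<lfloor>r\<rfloor> \<in> {-1, 0}" by (simp add: floor_of_abs_less_1)
next
  have "r \<noteq> -1" using assms by auto
  moreover assume "\<lfloor>r\<rfloor> \<in> {-1, 0}"
  then have "-1 \<le> r \<and> r < 1" by (auto simp: floor_eq_iff)
  ultimately show "\<bar>r\<bar> < 1" by auto
qed

lemma floor_minus_nonint:
  fixes r :: real
  assumes "r \<notin> \<int>"
  shows "\<lfloor>- r\<rfloor> = - \<lfloor>r\<rfloor> - 1"
proof (rule floor_unique)
  have "r \<noteq> of_int \<lfloor>r\<rfloor>" using assms by (metis Ints_of_int)
  then have "of_int \<lfloor>r\<rfloor> < r" using of_int_floor_le[of r] by linarith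
  then show "- r < of_int (- \<lfloor>r\<rfloor> - 1) + 1" by simp
qed (simp, linarith)

lemma finite_sets_separate:
  fixes A B :: "'a :: unbounded_dense_linorder set"
  assumes "finite A" "finite B" and "\<And>a b. a \<in> A \<Longrightarrow> b \<in> B \<Longrightarrow> a < b"
  shows "\<exists>v. (\<forall>a\<in>A. a < v) \<and> (\<forall>b\<in>B. v < b)"
proof (cases "A = {} \<or> B = {}")
  case True
  then show ?thesis
    using assms gt_ex[of "Max A"] lt_ex[of "Min B"]
    by (cases "A = {}"; cases "B = {}") auto
next
  case False
  then have "Max A < Min B" using assms by simp
  then obtain v where "Max A < v" "v < Min B" using dense by blast
  then show ?thesis using assms False by auto
qed

text \<open>One-point extension in a single coordinate. Each pair in \<open>P\<close> confines
  \<open>v\<close> to an open interval from \<open>lo\<close> to \<open>hi\<close>; finitely many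
  such intervals meet as soon as every lower end is below every upper end, which involves only two
  pairs at a time.\<close>

lemma floor_difference_extension:
  fixes P :: "(real \<times> real) set" and u d :: real
  assumes "finite P" "0 < d"
    and eq: "\<And>a b a' b'. (a, b) \<in> P \<Longrightarrow> (a', b') \<in> P \<Longrightarrow> \<lfloor>(a - a') / d\<rfloor> = \<lfloor>(b - b') / d\<rfloor>"
  shows "\<exists>v. \<forall>(a, b)\<in>P. of_int \<lfloor>(u - a) / d\<rfloor> < (v - b) / d \<and> (v - b) / d < of_int \<lfloor>(u - a) / d\<rfloor> + 1"
proof -
  define lo where "lo = (\<lambda>(a, b). b + d * of_int \<lfloor>(u - a) / d\<rfloor>)"
  define hi where "hi = (\<lambda>(a, b). b + d * (of_int \<lfloor>(u - a) / d\<rfloor> + 1))"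
  have "lo p < hi p'" if p: "p \<in> P" "p' \<in> P" for p p'
  proof -
    obtain a b a' b' where pp: "p = (a, b)" "p' = (a', b')" by fastforce
    have "(a - a') / d = (u - a') / d - (u - a) / d"
      by (simp add: diff_divide_distrib)
    also have "\<dots> < of_int (\<lfloor>(u - a') / d\<rfloor> + 1 - \<lfloor>(u - a) / d\<rfloor>)"
      by simp linarith
    \<comment> \<open>A strict upper bound by an integer depends only on the floor, so it passes
      from \<open>a - a'\<close> to \<open>b - b'\<close>.\<close>
    finally have "\<lfloor>(a - a') / d\<rfloor> < \<lfloor>(u - a') / d\<rfloor> + 1 - \<lfloor>(u - a) / d\<rfloor>"
      by (simp only: floor_less_iff)
    then have "\<lfloor>(b - b') / d\<rfloor> < \<lfloor>(u - a') / d\<rfloor> + 1 - \<lfloor>(u - a) / d\<rfloor>"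
      using eq[of a b a' b'] p pp by simp
    then have "(b - b') / d < of_int (\<lfloor>(u - a') / d\<rfloor> + 1 - \<lfloor>(u - a) / d\<rfloor>)"
      by (simp only: floor_less_iff)
    then have "b - b' < of_int (\<lfloor>(u - a') / d\<rfloor> + 1 - \<lfloor>(u - a) / d\<rfloor>) * d"
      by (simp only: pos_divide_less_eq[OF \<open>0 < d\<close>])
    then show ?thesis
      by (simp add: lo_def hi_def pp algebra_simps)
  qed
  then have "\<exists>v. (\<forall>a\<in>lo ` P. a < v) \<and> (\<forall>b\<in>hi ` P. v < b)"
    using \<open>finite P\<close> by (intro finite_sets_separate) blast+
  then obtain v where v: "\<forall>p\<in>P. lo p < v" "\<forall>p\<in>P. v < hi p"
    by blast
  have "of_int \<lfloor>(u - a) / d\<rfloor> < (v - b) / d \<and> (v - b) / d < of_int \<lfloor>(u - a) / d\<rfloor> + 1"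
    if "(a, b) \<in> P" for a b
    using v that \<open>0 < d\<close> by (fastforce simp: lo_def hi_def less_divide_eq divide_less_eq algebra_simps)
  then show ?thesis by blast
qed

lemma open_coord_vimage: "open S \<Longrightarrow> open {y :: c0. coord y n \<in> S}"
  using continuous_on_coord open_vimage[of S "\<lambda>y. coord y n"] by (simp add: vimage_def)

text \<open>\<open>X\<close> collects the at most two points whose coordinates may differ by multiples of \<open>d\<close>.\<close>

locale generic_sequence =
  fixes x :: "nat \<Rightarrow> c0" and d :: real and X :: "nat set"
  assumes d_pos: "0 < d" and finite_X: "finite X"
    and coord_neq: "\<And>i j n. i \<noteq> j \<Longrightarrow> coord (x i) n \<noteq> coord (x j) n"
    and X_separated: "\<And>i j. i \<in> X \<Longrightarrow> j \<in> X \<Longrightarrow> i \<noteq> j \<Longrightarrow> d \<le> norm (x i - x j)"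
    and no_tie: "\<And>i j n. i \<noteq> j \<Longrightarrow> i \<notin> X \<or> j \<notin> X \<Longrightarrow> (coord (x i) n - coord (x j) n) / d \<notin> \<int>"
    and order_pattern: "\<And>js. distinct js \<Longrightarrow> infinite {n. sorted_wrt (<) (map (\<lambda>j. coord (x j) n) js)}"
begin

section \<open>Cells, the extension property and partial isomorphisms\<close>

definition cell :: "nat \<Rightarrow> nat \<Rightarrow> nat \<Rightarrow> int" where
  "cell n i j = \<lfloor>(coord (x i) n - coord (x j) n) / d\<rfloor>"

text \<open>The deterministic content of almost every sample. Pairs at distance at least
  \<open>d\<close> never form an edge, so adjacencies are prescribed only for open sets lying
  entirely within distance \<open>d\<close> of each point of \<open>S \<union> T\<close>.\<close>

definition extensible :: "(nat \<Rightarrow> nat \<Rightarrow> bool) \<Rightarrow> bool" where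
  "extensible e \<longleftrightarrow> (\<forall>i j. e i j \<longrightarrow> e j i \<and> i \<noteq> j \<and> norm (x i - x j) < d) \<and>
     (\<forall>U S T. open U \<and> U \<noteq> {} \<and> finite S \<and> finite T \<and> S \<inter> T = {} \<and>
        (\<forall>y\<in>U. \<forall>j\<in>S \<union> T. norm (y - x j) < d) \<longrightarrow>
        infinite {k. x k \<in> U \<and> (\<forall>s\<in>S. e k s) \<and> (\<forall>t\<in>T. \<not> e k t)})"

lemma extensible_infinite:
  assumes "extensible e" "open U" "U \<noteq> {}" "finite S" "finite T" "S \<inter> T = {}"
    and "\<And>y j. y \<in> U \<Longrightarrow> j \<in> S \<union> T \<Longrightarrow> norm (y - x j) < d"
  shows "infinite {k. x k \<in> U \<and> (\<forall>s\<in>S. e k s) \<and> (\<forall>t\<in>T. \<not> e k t)}"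
proof -
  have "\<forall>y\<in>U. \<forall>j\<in>S \<union> T. norm (y - x j) < d"
    using assms(7) by blast
  then show ?thesis
    using assms(1)[unfolded extensible_def, THEN conjunct2, THEN spec[of _ U], THEN spec[of _ S],
        THEN spec[of _ T]] assms(2-6) by satx
qed

text \<open>\<open>R\<close> matches indices of points and \<open>Q\<close> matches coordinates.\<close>

definition partial_iso ::
    "(nat \<Rightarrow> nat \<Rightarrow> bool) \<Rightarrow> (nat \<Rightarrow> nat \<Rightarrow> bool) \<Rightarrow> (nat \<times> nat) set \<Rightarrow> (nat \<times> nat) set \<Rightarrow> bool" where
  "partial_iso e e' R Q \<longleftrightarrow>
     finite R \<and> finite Q \<and> X \<subseteq> Domain R \<and> X \<subseteq> Range R \<and>
     (\<forall>i j j'. (i, j) \<in> R \<longrightarrow> (i, j') \<in> R \<longrightarrow> j = j') \<and>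
     (\<forall>i i' j. (i, j) \<in> R \<longrightarrow> (i', j) \<in> R \<longrightarrow> i = i') \<and>
     (\<forall>n m m'. (n, m) \<in> Q \<longrightarrow> (n, m') \<in> Q \<longrightarrow> m = m') \<and>
     (\<forall>n n' m. (n, m) \<in> Q \<longrightarrow> (n', m) \<in> Q \<longrightarrow> n = n') \<and>
     (\<forall>i j i' j'. (i, j) \<in> R \<longrightarrow> (i', j') \<in> R \<longrightarrow> e i i' = e' j j') \<and>
     (\<forall>i j i' j' n m. (i, j) \<in> R \<longrightarrow> (i', j') \<in> R \<longrightarrow> (n, m) \<in> Q \<longrightarrow> cell n i i' = cell m j j') \<and>
     (\<forall>i j n. (i, j) \<in> R \<longrightarrow> n \<notin> Domain Q \<longrightarrow> \<bar>coord (x i) n\<bar> < d / 4) \<and>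
     (\<forall>i j m. (i, j) \<in> R \<longrightarrow> m \<notin> Range Q \<longrightarrow> \<bar>coord (x j) m\<bar> < d / 4)"

lemma partial_isoD:
  assumes "partial_iso e e' R Q"
  shows "finite R" "finite Q" "X \<subseteq> Domain R" "X \<subseteq> Range R"
    and "\<And>i j j'. (i, j) \<in> R \<Longrightarrow> (i, j') \<in> R \<Longrightarrow> j = j'"
    and "\<And>i i' j. (i, j) \<in> R \<Longrightarrow> (i', j) \<in> R \<Longrightarrow> i = i'"
    and "\<And>n m m'. (n, m) \<in> Q \<Longrightarrow> (n, m') \<in> Q \<Longrightarrow> m = m'"
    and "\<And>n n' m. (n, m) \<in> Q \<Longrightarrow> (n', m) \<in> Q \<Longrightarrow> n = n'"
    and "\<And>i j i' j'. (i, j) \<in> R \<Longrightarrow> (i', j') \<in> R \<Longrightarrow> e i i' = e' j j'"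
    and "\<And>i j i' j' n m. (i, j) \<in> R \<Longrightarrow> (i', j') \<in> R \<Longrightarrow> (n, m) \<in> Q \<Longrightarrow> cell n i i' = cell m j j'"
    and "\<And>i j n. (i, j) \<in> R \<Longrightarrow> n \<notin> Domain Q \<Longrightarrow> \<bar>coord (x i) n\<bar> < d / 4"
    and "\<And>i j m. (i, j) \<in> R \<Longrightarrow> m \<notin> Range Q \<Longrightarrow> \<bar>coord (x j) m\<bar> < d / 4"
proof -
  note c = assms[unfolded partial_iso_def]
  show "finite R" by (rule c[THEN conjunct1])
  note c = c[THEN conjunct2]
  show "finite Q" by (rule c[THEN conjunct1])
  note c = c[THEN conjunct2]
  show "X \<subseteq> Domain R" by (rule c[THEN conjunct1])
  note c = c[THEN conjunct2]
  show "X \<subseteq> Range R" by (rule c[THEN conjunct1])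
  note c = c[THEN conjunct2]
  show "\<And>i j j'. (i, j) \<in> R \<Longrightarrow> (i, j') \<in> R \<Longrightarrow> j = j'"
    by (rule c[THEN conjunct1, rule_format])
  note c = c[THEN conjunct2]
  show "\<And>i i' j. (i, j) \<in> R \<Longrightarrow> (i', j) \<in> R \<Longrightarrow> i = i'"
    by (rule c[THEN conjunct1, rule_format])
  note c = c[THEN conjunct2]
  show "\<And>n m m'. (n, m) \<in> Q \<Longrightarrow> (n, m') \<in> Q \<Longrightarrow> m = m'"
    by (rule c[THEN conjunct1, rule_format])
  note c = c[THEN conjunct2]
  show "\<And>n n' m. (n, m) \<in> Q \<Longrightarrow> (n', m) \<in> Q \<Longrightarrow> n = n'"
    by (rule c[THEN conjunct1, rule_format])
  note c = c[THEN conjunct2]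
  show "\<And>i j i' j'. (i, j) \<in> R \<Longrightarrow> (i', j') \<in> R \<Longrightarrow> e i i' = e' j j'"
    by (rule c[THEN conjunct1, rule_format])
  note c = c[THEN conjunct2]
  show "\<And>i j i' j' n m. (i, j) \<in> R \<Longrightarrow> (i', j') \<in> R \<Longrightarrow> (n, m) \<in> Q \<Longrightarrow> cell n i i' = cell m j j'"
    by (rule c[THEN conjunct1, rule_format])
  note c = c[THEN conjunct2]
  show "\<And>i j n. (i, j) \<in> R \<Longrightarrow> n \<notin> Domain Q \<Longrightarrow> \<bar>coord (x i) n\<bar> < d / 4"
    by (rule c[THEN conjunct1, rule_format])
  note c = c[THEN conjunct2]
  show "\<And>i j m. (i, j) \<in> R \<Longrightarrow> m \<notin> Range Q \<Longrightarrow> \<bar>coord (x j) m\<bar> < d / 4"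
    by (rule c[rule_format])
qed

lemma partial_isoI:
  assumes "finite R" "finite Q" "X \<subseteq> Domain R" "X \<subseteq> Range R"
    and "\<And>i j j'. (i, j) \<in> R \<Longrightarrow> (i, j') \<in> R \<Longrightarrow> j = j'"
    and "\<And>i i' j. (i, j) \<in> R \<Longrightarrow> (i', j) \<in> R \<Longrightarrow> i = i'"
    and "\<And>n m m'. (n, m) \<in> Q \<Longrightarrow> (n, m') \<in> Q \<Longrightarrow> m = m'"
    and "\<And>n n' m. (n, m) \<in> Q \<Longrightarrow> (n', m) \<in> Q \<Longrightarrow> n = n'"
    and "\<And>i j i' j'. (i, j) \<in> R \<Longrightarrow> (i', j') \<in> R \<Longrightarrow> e i i' = e' j j'"
    and "\<And>i j i' j' n m. (i, j) \<in> R \<Longrightarrow> (i', j') \<in> R \<Longrightarrow> (n, m) \<in> Q \<Longrightarrow> cell n i i' = cell m j j'"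
    and "\<And>i j n. (i, j) \<in> R \<Longrightarrow> n \<notin> Domain Q \<Longrightarrow> \<bar>coord (x i) n\<bar> < d / 4"
    and "\<And>i j m. (i, j) \<in> R \<Longrightarrow> m \<notin> Range Q \<Longrightarrow> \<bar>coord (x j) m\<bar> < d / 4"
  shows "partial_iso e e' R Q"
  unfolding partial_iso_def
  by (intro conjI allI impI) (rule assms; assumption)+

text \<open>The conditions are symmetric in source and target, so the back step reduces to the forth
  step.\<close>

lemma partial_iso_converse:
  assumes "partial_iso e e' R Q"
  shows "partial_iso e' e (R\<inverse>) (Q\<inverse>)"
proof (rule partial_isoI)
  note D = partial_isoD[OF assms]
  show "finite (R\<inverse>)" "finite (Q\<inverse>)" "X \<subseteq> Domain (R\<inverse>)" "X \<subseteq> Range (R\<inverse>)"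
    using D(1-4) by simp_all
  show "j = j'" if "(i, j) \<in> R\<inverse>" "(i, j') \<in> R\<inverse>" for i j j'
    using D(6) that by blast
  show "i = i'" if "(i, j) \<in> R\<inverse>" "(i', j) \<in> R\<inverse>" for i i' j
    using D(5) that by blast
  show "m = m'" if "(n, m) \<in> Q\<inverse>" "(n, m') \<in> Q\<inverse>" for n m m'
    using D(8) that by blast
  show "n = n'" if "(n, m) \<in> Q\<inverse>" "(n', m) \<in> Q\<inverse>" for n n' m
    using D(7) that by blast
  show "e' i i' = e j j'" if "(i, j) \<in> R\<inverse>" "(i', j') \<in> R\<inverse>" for i j i' j'
    using D(9)[of j i j' i'] that by simp
  show "cell n i i' = cell m j j'" if "(i, j) \<in> R\<inverse>" "(i', j') \<in> R\<inverse>" "(n, m) \<in> Q\<inverse>" for i j i' j' n m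
    using D(10)[of j i j' i' m n] that by simp
  show "\<bar>coord (x i) n\<bar> < d / 4" if "(i, j) \<in> R\<inverse>" "n \<notin> Domain (Q\<inverse>)" for i j n
    using D(12)[of j i n] that by simp
  show "\<bar>coord (x j) m\<bar> < d / 4" if "(i, j) \<in> R\<inverse>" "m \<notin> Range (Q\<inverse>)" for i j m
    using D(11)[of j i m] that by simp
qed

text \<open>The difference is below \<open>d / 2\<close>, so the cell records nothing but the order
  of the two coordinates.\<close>

lemma cell_small:
  assumes "\<bar>coord (x i) n\<bar> < d / 4" "\<bar>coord (x j) n\<bar> < d / 4"
  shows "cell n i j = (if coord (x j) n \<le> coord (x i) n then 0 else -1)"
proof -
  have "\<bar>(coord (x i) n - coord (x j) n) / d\<bar> < 1"
    using assms d_pos by (auto simp: abs_less_iff field_simps)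
  then show ?thesis
    using d_pos by (simp add: cell_def floor_of_abs_less_1 zero_le_divide_iff)
qed

lemma cell_swap: "i \<noteq> j \<Longrightarrow> i \<notin> X \<or> j \<notin> X \<Longrightarrow> cell n j i = - cell n i j - 1"
  using floor_minus_nonint[OF no_tie[of i j n]] by (simp add: cell_def minus_divide_left)

text \<open>Outside \<open>D\<close> the coordinates differ by less than \<open>d / 2\<close>
  anyway, so the cells over \<open>D\<close> decide closeness; \<open>D\<close> will be the set of
  matched coordinates.\<close>

lemma norm_less_iff_cells:
  assumes ij: "i \<noteq> j" "i \<notin> X \<or> j \<notin> X"
    and "\<And>n. n \<notin> D \<Longrightarrow> \<bar>coord (x i) n\<bar> < d / 4" "\<And>n. n \<notin> D \<Longrightarrow> \<bar>coord (x j) n\<bar> < d / 4"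
  shows "norm (x i - x j) < d \<longleftrightarrow> (\<forall>n\<in>D. cell n i j \<in> {-1, 0})"
proof -
  have "\<bar>coord (x i - x j) n\<bar> < d" if "n \<notin> D" for n
    using assms(3,4)[OF that] d_pos by simp
  moreover have "\<bar>coord (x i - x j) n\<bar> < d \<longleftrightarrow> cell n i j \<in> {-1, 0}" for n
    using abs_less_1_iff_floor[OF no_tie[OF ij, of n]] d_pos
    by (simp add: cell_def)
  ultimately show ?thesis
    using d_pos by (auto simp: norm_c0_less_iff)
qed

section \<open>Extension of partial isomorphisms by coordinates and by vertices\<close>

text \<open>In an unmatched coordinate all points treated so far are small, so only their order has
  to be reproduced. \<open>order_pattern\<close> offers infinitely many target coordinates with this
  order, and only finitely many are in use.\<close>

lemma extend_coordinate:
  assumes "partial_iso e e' R Q"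
  shows "\<exists>Q'. Q \<subseteq> Q' \<and> partial_iso e e' R Q' \<and> n \<in> Domain Q'"
proof (cases "n \<in> Domain Q")
  case True
  then show ?thesis using assms by blast
next
  case n: False
  note D = partial_isoD[OF assms]
  obtain l0 where l0: "set l0 = R" "distinct l0"
    using finite_distinct_list D(1) by blast
  \<comment> \<open>The pairs are sorted by source coordinate, so \<open>map snd l\<close> is the
    order required of the images.\<close>
  define l where "l = sort_key (\<lambda>(i, j). coord (x i) n) l0"
  have l: "set l = R" "distinct l" using l0 by (auto simp: l_def)
  have "inj_on (\<lambda>(i, j). coord (x i) n) R"
    by (rule inj_onI) (clarsimp, metis D(5) coord_neq)
  then have "distinct (map (\<lambda>(i, j). coord (x i) n) l)"
    using l by (simp add: distinct_map)
  moreover have "sorted (map (\<lambda>(i, j). coord (x i) n) l)"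
    unfolding l_def by (rule sorted_sort_key)
  ultimately have sort_n: "sorted_wrt (<) (map (\<lambda>(i, j). coord (x i) n) l)"
    by (simp add: strict_sorted_iff)
  have "distinct (map snd l)"
    using l D(6) by (auto simp: distinct_map inj_on_def)
  then have "infinite ({m. sorted_wrt (<) (map (\<lambda>j. coord (x j) m) (map snd l))} - Range Q)"
    using order_pattern[of "map snd l"] D(2) by (intro Diff_infinite_finite finite_Range)
  then obtain m where m: "m \<notin> Range Q" "sorted_wrt (<) (map (\<lambda>j. coord (x j) m) (map snd l))"
    by (auto dest!: infinite_imp_nonempty simp del: map_map)
  have less: "coord (x j) m < coord (x j') m"
    if p: "(i, j) \<in> R" "(i', j') \<in> R" "coord (x i) n < coord (x i') n" for i j i' j'
  proof -
    obtain a b where a: "a < length l" "l ! a = (i, j)" and b: "b < length l" "l ! b = (i', j')"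
      using p l(1) by (metis in_set_conv_nth)
    have "\<not> b < a"
      using sorted_wrt_nth_less[OF sort_n, of b a] a b p by auto
    moreover have "a \<noteq> b" using a b p by auto
    ultimately show ?thesis
      using sorted_wrt_nth_less[OF m(2), of a b] a b by simp
  qed
  have cell_nm: "cell n i i' = cell m j j'" if p: "(i, j) \<in> R" "(i', j') \<in> R" for i j i' j'
  proof (cases "i = i'")
    case True
    moreover have "j = j'" using True p D(5) by blast
    ultimately show ?thesis by (simp add: cell_def)
  next
    case False
    then have "coord (x i') n \<le> coord (x i) n \<longleftrightarrow> coord (x j') m \<le> coord (x j) m"
      using less[OF p] less[OF p(2,1)] coord_neq[OF False, of n] by force
    then show ?thesis
      using p D(11,12) n m(1) by (simp add: cell_small)
  qed
  have "partial_iso e e' R (insert (n, m) Q)"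
  proof (rule partial_isoI)
    show "b = b'" if "(a, b) \<in> insert (n, m) Q" "(a, b') \<in> insert (n, m) Q" for a b b'
      using that D(7) n by blast
    show "a = a'" if "(a, b) \<in> insert (n, m) Q" "(a', b) \<in> insert (n, m) Q" for a a' b
      using that D(8) m(1) by blast
    show "\<bar>coord (x i) k\<bar> < d / 4" if "(i, j) \<in> R" "k \<notin> Domain (insert (n, m) Q)" for i j k
      using that(2) by (intro D(11)[OF that(1)]) simp
    show "\<bar>coord (x j) k\<bar> < d / 4" if "(i, j) \<in> R" "k \<notin> Range (insert (n, m) Q)" for i j k
      using that(2) by (intro D(12)[OF that(1)]) simp
    show "cell a i i' = cell b j j'"
      if "(i, j) \<in> R" "(i', j') \<in> R" "(a, b) \<in> insert (n, m) Q" for i j i' j' a b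
      using that(3) cell_nm[OF that(1,2)] D(10)[OF that(1,2)] by blast
    show "finite (insert (n, m) Q)" using D(2) by simp
  qed (fact D)+
  then show ?thesis by blast
qed

lemma extend_coordinates:
  assumes "partial_iso e e' R Q" "finite N"
  shows "\<exists>Q'. Q \<subseteq> Q' \<and> partial_iso e e' R Q' \<and> N \<subseteq> Domain Q'"
  using \<open>finite N\<close>
proof induction
  case empty
  then show ?case using assms by blast
next
  case (insert n N)
  then obtain Q' where "Q \<subseteq> Q'" "partial_iso e e' R Q'" "N \<subseteq> Domain Q'" by blast
  with extend_coordinate[of e e' R Q' n] show ?case by (meson Domain_mono insert_subset order_trans)
qed

lemma finite_large_coords: "finite {n. d / 4 \<le> \<bar>coord y n\<bar>}"
proof -
  obtain N where "\<And>n. n \<ge> N \<Longrightarrow> \<bar>coord y n\<bar> < d / 4"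
    using LIMSEQ_D[OF coord_tendsto_0, of "d / 4" y] d_pos by auto
  then have "{n. d / 4 \<le> \<bar>coord y n\<bar>} \<subseteq> {..<N}"
    by (force simp: not_le[symmetric])
  then show ?thesis by (rule finite_subset) simp
qed

text \<open>The forth step. Coordinates in which \<open>x u\<close> is large are matched first; then
  the admissible positions of the image contain a nonempty open set, in which the extension property
  yields a vertex with the right adjacencies.\<close>

lemma extend_vertex:
  assumes iso: "partial_iso e e' R Q" and e: "extensible e" and e': "extensible e'"
  shows "\<exists>R' Q'. R \<subseteq> R' \<and> partial_iso e e' R' Q' \<and> u \<in> Domain R'"
proof (cases "u \<in> Domain R")
  case True
  then show ?thesis using iso by blast
next
  case u: False
  obtain Q' where Q': "partial_iso e e' R Q'" "{n. d / 4 \<le> \<bar>coord (x u) n\<bar>} \<subseteq> Domain Q'"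
    using extend_coordinates[OF iso finite_large_coords] by blast
  note D = partial_isoD[OF Q'(1)]
  have u_small: "\<bar>coord (x u) n\<bar> < d / 4" if "n \<notin> Domain Q'" for n
    using Q'(2) that by force
  have uX: "u \<notin> X" using u D(3) by blast
  \<comment> \<open>Strict inequalities on both sides keep the set of admissible values
    open.\<close>
  define fits where "fits n m v \<longleftrightarrow> (\<forall>(i, j)\<in>R. of_int (cell n u i) < (v - coord (x j) m) / d \<and>
      (v - coord (x j) m) / d < of_int (cell n u i) + 1)" for n m and v :: real
  have "\<exists>v. \<forall>n. (n, m) \<in> Q' \<longrightarrow> fits n m v" for m
  proof (cases "m \<in> Range Q'")
    case True
    then obtain n where n: "(n, m) \<in> Q'" by blast
    let ?P = "(\<lambda>(i, j). (coord (x i) n, coord (x j) m)) ` R"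
    have "\<exists>v. \<forall>(a, b)\<in>?P. of_int \<lfloor>(coord (x u) n - a) / d\<rfloor> < (v - b) / d \<and>
        (v - b) / d < of_int \<lfloor>(coord (x u) n - a) / d\<rfloor> + 1"
      using D(1,10) n d_pos by (intro floor_difference_extension) (auto simp: cell_def)
    then obtain v where "fits n m v"
      by (auto simp: fits_def cell_def case_prod_beta)
    then show ?thesis using n D(8) by blast
  qed auto
  then obtain z where z: "\<And>n m. (n, m) \<in> Q' \<Longrightarrow> fits n m (z m)" by metis
  \<comment> \<open>The default 0 in unmatched coordinates, with the radius \<open>d / 4\<close> in
    \<open>U\<close>, keeps the new image small there.\<close>
  define c where "c = Abs_c0 (\<lambda>m. if m \<in> Range Q' then z m else 0)"
  have c: "coord c m = (if m \<in> Range Q' then z m else 0)" for m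
  proof -
    obtain N where "Range Q' \<subseteq> {..<N}"
      using D(2) by (metis finite_Range finite_nat_iff_bounded)
    then have "(\<lambda>m. if m \<in> Range Q' then z m else 0) \<longlonglongrightarrow> 0"
      by (intro tendsto_eventually eventually_sequentiallyI[of N]) auto
    then show ?thesis by (simp add: c_def Abs_c0_inverse)
  qed
  define U where "U = ball c (d / 4) \<inter> (\<Inter>q\<in>Q'. \<Inter>p\<in>R. {y. coord y (snd q) \<in>
      {coord (x (snd p)) (snd q) + d * of_int (cell (fst q) u (fst p)) <..<
        coord (x (snd p)) (snd q) + d * (of_int (cell (fst q) u (fst p)) + 1)}})"
  have U_iff: "y \<in> U \<longleftrightarrow> dist c y < d / 4 \<and> (\<forall>(n, m)\<in>Q'. fits n m (coord y m))" for y
    using d_pos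
    by (simp add: U_def fits_def case_prod_beta less_divide_eq divide_less_eq algebra_simps)
  have "open U"
    unfolding U_def using D(1,2) by (intro open_Int open_ball open_INT ballI open_coord_vimage) auto
  have "c \<in> U"
    using z d_pos c by (auto simp: U_iff)
  have y_small: "\<bar>coord y m\<bar> < d / 4" if "y \<in> U" "m \<notin> Range Q'" for y m
    using that abs_coord_le_norm[of "c - y" m] by (simp add: U_iff dist_norm c)
  have bounds: "of_int (cell n u i) < (coord y m - coord (x j) m) / d"
    "(coord y m - coord (x j) m) / d < of_int (cell n u i) + 1"
    if "y \<in> U" "(n, m) \<in> Q'" "(i, j) \<in> R" for y n m i j
    using that by (auto simp: U_iff fits_def)
  have near_u: "norm (x u - x i) < d \<longleftrightarrow> (\<forall>n\<in>Domain Q'. cell n u i \<in> {-1, 0})" if "(i, j) \<in> R" for i j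
    using that u uX u_small D(11) by (intro norm_less_iff_cells) auto
  define S where "S = {j. \<exists>i. (i, j) \<in> R \<and> e u i}"
  \<comment> \<open>Only non-neighbours within distance \<open>d\<close> are listed: farther
    vertices cannot be adjacent, and the extension property does not cover them.\<close>
  define T where "T = {j. \<exists>i. (i, j) \<in> R \<and> \<not> e u i \<and> norm (x u - x i) < d}"
  have near: "norm (x u - x i) < d" if "e u i" for i
    using that e by (auto simp: extensible_def)
  have "finite S" "finite T"
    using D(1) by (auto simp: S_def T_def intro: finite_subset[OF _ finite_Range[of R]])
  moreover have "S \<inter> T = {}"
    using D(6) by (auto simp: S_def T_def)
  moreover have "norm (y - x j) < d" if y: "y \<in> U" and j: "j \<in> S \<union> T" for y j
  proof -
    obtain i where i: "(i, j) \<in> R" "norm (x u - x i) < d"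
      using j near by (auto simp: S_def T_def)
    have "\<bar>coord (y - x j) m\<bar> < d" for m
    proof (cases "m \<in> Range Q'")
      case True
      then obtain n where n: "(n, m) \<in> Q'" by blast
      then have "cell n u i \<in> {-1, 0}" using near_u i by blast
      then have "-1 < (coord y m - coord (x j) m) / d" "(coord y m - coord (x j) m) / d < 1"
        using bounds[OF y n i(1)] by auto
      then show ?thesis
        using d_pos by (simp add: abs_less_iff less_divide_eq divide_less_eq)
    next
      case False
      then show ?thesis
        using y_small[OF y False] D(12)[OF i(1) False] d_pos by simp
    qed
    then show ?thesis using d_pos by (simp add: norm_c0_less_iff)
  qed
  ultimately have "infinite {k. x k \<in> U \<and> (\<forall>s\<in>S. e' k s) \<and> (\<forall>t\<in>T. \<not> e' k t)}"
    using \<open>c \<in> U\<close> by (intro extensible_infinite[OF e' \<open>open U\<close>]; blast)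
  then have "infinite ({k. x k \<in> U \<and> (\<forall>s\<in>S. e' k s) \<and> (\<forall>t\<in>T. \<not> e' k t)} - Range R)"
    using D(1) by (intro Diff_infinite_finite finite_Range)
  then obtain k where k: "k \<notin> Range R" "x k \<in> U" "\<forall>s\<in>S. e' k s" "\<forall>t\<in>T. \<not> e' k t"
    by (auto dest!: infinite_imp_nonempty)
  have kX: "k \<notin> X" using k D(4) by blast
  have cell_k: "cell m k j = cell n u i" if "(i, j) \<in> R" "(n, m) \<in> Q'" for i j n m
    using bounds[OF k(2) that(2,1)] unfolding cell_def by (intro floor_unique) auto
  \<comment> \<open>Neither \<open>u\<close> nor \<open>k\<close> lies in \<open>X\<close>, so there
    are no ties and each cell determines the reversed one.\<close>
  have cell_k': "cell m j k = cell n i u" if "(i, j) \<in> R" "(n, m) \<in> Q'" for i j n m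
  proof -
    have "u \<noteq> i" "k \<noteq> j" using that u k by auto
    then show ?thesis using cell_k[OF that] cell_swap[of u i n] cell_swap[of k j m] uX kX by simp
  qed
  have edge: "e u i \<longleftrightarrow> e' k j" if ij: "(i, j) \<in> R" for i j
  proof (cases "norm (x u - x i) < d")
    case True
    then show ?thesis using k ij by (auto simp: S_def T_def)
  next
    case False
    \<comment> \<open>Equal cells carry distance at least \<open>d\<close> over to the image pair,
      so neither pair is an edge.\<close>
    have "norm (x k - x j) < d \<longleftrightarrow> (\<forall>m\<in>Range Q'. cell m k j \<in> {-1, 0})"
      using ij k kX y_small D(12) by (intro norm_less_iff_cells) auto
    also have "\<dots> \<longleftrightarrow> (\<forall>(n, m)\<in>Q'. cell m k j \<in> {-1, 0})"
      by blast
    also have "\<dots> \<longleftrightarrow> (\<forall>(n, m)\<in>Q'. cell n u i \<in> {-1, 0})"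
      using cell_k[OF ij] by (intro ball_cong) auto
    also have "\<dots> \<longleftrightarrow> norm (x u - x i) < d"
      using near_u[OF ij] by blast
    finally have "norm (x k - x j) < d \<longleftrightarrow> norm (x u - x i) < d" .
    then show ?thesis using False near e' by (auto simp: extensible_def)
  qed
  have sym: "f i j = f j i" if "extensible f" for f i j
    using that by (auto simp: extensible_def)
  have irr: "\<not> f i i" if "extensible f" for f i
    using that by (auto simp: extensible_def)
  have "partial_iso e e' (insert (u, k) R) Q'"
  proof (rule partial_isoI)
    show "e i i' = e' j j'" if "(i, j) \<in> insert (u, k) R" "(i', j') \<in> insert (u, k) R" for i j i' j'
      using that D(9) edge sym[OF e] sym[OF e'] irr[OF e] irr[OF e'] by blast
    show "cell n i i' = cell m j j'"
      if "(i, j) \<in> insert (u, k) R" "(i', j') \<in> insert (u, k) R" "(n, m) \<in> Q'" for i j i' j' n m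
    proof -
      have "cell n u u = cell m k k" by (simp add: cell_def)
      then show ?thesis
        using that D(10) cell_k cell_k' by auto
    qed
    show "\<bar>coord (x i) n\<bar> < d / 4" if "(i, j) \<in> insert (u, k) R" "n \<notin> Domain Q'" for i j n
      using that u_small D(11) by blast
    show "\<bar>coord (x j) m\<bar> < d / 4" if "(i, j) \<in> insert (u, k) R" "m \<notin> Range Q'" for i j m
      using that y_small[OF k(2)] D(12) by blast
    show "finite (insert (u, k) R)" "finite Q'"
      using D(1,2) by simp_all
    show "X \<subseteq> Domain (insert (u, k) R)" "X \<subseteq> Range (insert (u, k) R)"
      using D(3,4) by auto
    show "j = j'" if "(i, j) \<in> insert (u, k) R" "(i, j') \<in> insert (u, k) R" for i j j'
      using that D(5) u by blast
    show "i = i'" if "(i, j) \<in> insert (u, k) R" "(i', j) \<in> insert (u, k) R" for i i' j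
      using that D(6) k(1) by blast
  qed (fact D(7,8))+
  then show ?thesis by blast
qed

lemma extend_both:
  assumes iso: "partial_iso e e' R Q" and e: "extensible e" "extensible e'"
  shows "\<exists>R' Q'. R \<subseteq> R' \<and> partial_iso e e' R' Q' \<and> u \<in> Domain R' \<and> u \<in> Range R'"
proof -
  obtain R' Q' where 1: "R \<subseteq> R'" "partial_iso e e' R' Q'" "u \<in> Domain R'"
    using extend_vertex[OF iso e] by blast
  obtain R'' Q'' where 2: "R'\<inverse> \<subseteq> R''" "partial_iso e' e R'' Q''" "u \<in> Domain R''"
    using extend_vertex[OF partial_iso_converse[OF 1(2)] e(2,1)] by blast
  show ?thesis
    using 1 2 partial_iso_converse[OF 2(2)] by (intro exI[of _ "R''\<inverse>"] exI[of _ "Q''\<inverse>"]) auto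
qed

section \<open>Limit of the back-and-forth\<close>

text \<open>Distinct points of \<open>X\<close> are at distance at least \<open>d\<close>, hence
  non-adjacent in both graphs, so the identity preserves adjacency. It is paired with the identity
  on the coordinates in which some point of \<open>X\<close> is large.\<close>

lemma partial_iso_start:
  assumes "extensible e" "extensible e'"
  shows "partial_iso e e' (Id_on X) (Id_on (\<Union>i\<in>X. {n. d / 4 \<le> \<bar>coord (x i) n\<bar>}))"
proof (rule partial_isoI)
  have finite_Id_on: "finite (Id_on A)" if "finite A" for A :: "nat set"
    using that by (simp add: Id_on_def)
  show "finite (Id_on X)" "finite (Id_on (\<Union>i\<in>X. {n. d / 4 \<le> \<bar>coord (x i) n\<bar>}))"
    using finite_X finite_large_coords by (intro finite_Id_on finite_UN_I; simp)+
  show "e i i' = e' j j'" if "(i, j) \<in> Id_on X" "(i', j') \<in> Id_on X" for i j i' j'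
    using that assms X_separated[of i i'] by (auto simp: extensible_def) (meson not_le)+
qed (auto simp: Id_on_iff not_le[symmetric])

text \<open>The union of a chain of partial isomorphisms whose \<open>n\<close>-th step puts
  \<open>n\<close> into domain and range. Only the vertex matchings are required to increase; each
  coordinate matching serves its own stage.\<close>

lemma extensible_iso:
  assumes e: "extensible e" "extensible e'"
  shows "\<exists>f. bij f \<and> (\<forall>i j. e i j \<longleftrightarrow> e' (f i) (f j))"
proof -
  have "\<exists>s. \<forall>n. partial_iso e e' (fst (s n)) (snd (s n)) \<and>
      fst (s n) \<subseteq> fst (s (Suc n)) \<and> n \<in> Domain (fst (s (Suc n))) \<and> n \<in> Range (fst (s (Suc n)))"
  proof (rule dependent_nat_choice)
    show "\<exists>s. partial_iso e e' (fst s) (snd s)"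
      using partial_iso_start[OF e] by (metis fst_conv snd_conv)
    fix s n assume "partial_iso e e' (fst s) (snd s)"
    then obtain R' Q' where "fst s \<subseteq> R'" "partial_iso e e' R' Q'" "n \<in> Domain R'" "n \<in> Range R'"
      using extend_both[OF _ e] by blast
    then show "\<exists>t. partial_iso e e' (fst t) (snd t) \<and>
        fst s \<subseteq> fst t \<and> n \<in> Domain (fst t) \<and> n \<in> Range (fst t)"
      by (intro exI[of _ "(R', Q')"]) simp
  qed
  then obtain s where s: "\<And>n. partial_iso e e' (fst (s n)) (snd (s n))"
      "\<And>n. fst (s n) \<subseteq> fst (s (Suc n))"
      "\<And>n. n \<in> Domain (fst (s (Suc n)))" "\<And>n. n \<in> Range (fst (s (Suc n)))"
    by blast
  define F where "F = (\<Union>n. fst (s n))"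
  have mono: "fst (s n) \<subseteq> fst (s m)" if "n \<le> m" for n m
    using lift_Suc_mono_le[of "\<lambda>n. fst (s n)", OF s(2) that] .
  have common: "\<exists>n. p \<in> fst (s n) \<and> q \<in> fst (s n)" if "p \<in> F" "q \<in> F" for p q
  proof -
    obtain n m where "p \<in> fst (s n)" "q \<in> fst (s m)" using \<open>p \<in> F\<close> \<open>q \<in> F\<close> by (auto simp: F_def)
    then show ?thesis
      using mono[of n "max n m"] mono[of m "max n m"] by auto
  qed
  have total: "\<exists>j. (i, j) \<in> F" "\<exists>j. (j, i) \<in> F" for i
    using s(3,4)[of i] by (auto simp: F_def)
  have uniq: "j = j'" if "(i, j) \<in> F" "(i, j') \<in> F" for i j j'
    using common[OF that] partial_isoD(5)[OF s(1)] by blast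
  have uniq': "i = i'" if "(i, j) \<in> F" "(i', j) \<in> F" for i i' j
    using common[OF that] partial_isoD(6)[OF s(1)] by blast
  have edge: "e i i' = e' j j'" if "(i, j) \<in> F" "(i', j') \<in> F" for i i' j j'
    using common[OF that] partial_isoD(9)[OF s(1)] by blast
  obtain f where f: "\<And>i. (i, f i) \<in> F" using total(1) by metis
  have "bij f"
  proof (rule bijI)
    show "inj f" using f uniq' by (metis injI)
    show "surj f" using f uniq total(2) by (metis surjI)
  qed
  then show ?thesis using edge f by blast
qed

end

subsection \<open>Uniqueness of the random graph\<close>

lemma doubleton_in_LARG_pairs:
  "{u, v} \<in> LARG_pairs V \<delta> \<longleftrightarrow> u \<in> V \<and> v \<in> V \<and> u \<noteq> v \<and> norm (u - v) < \<delta>"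
proof
  assume "{u, v} \<in> LARG_pairs V \<delta>"
  then obtain a b where "{u, v} = {a, b}" "a \<in> V" "b \<in> V" "a \<noteq> b" "norm (a - b) < \<delta>"
    unfolding LARG_pairs_def by blast
  moreover from this have "u = a \<and> v = b \<or> u = b \<and> v = a"
    by (simp add: doubleton_eq_iff)
  ultimately show "u \<in> V \<and> v \<in> V \<and> u \<noteq> v \<and> norm (u - v) < \<delta>"
    by (metis norm_minus_commute)
next
  assume "u \<in> V \<and> v \<in> V \<and> u \<noteq> v \<and> norm (u - v) < \<delta>"
  then show "{u, v} \<in> LARG_pairs V \<delta>"
    unfolding LARG_pairs_def by blast
qed

lemma simple_graph_LARG_graph: "simple_graph (LARG_graph V \<delta> \<omega>)"
  unfolding simple_graph_def
proof
  fix e assume "e \<in> snd (LARG_graph V \<delta> \<omega>)"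
  then obtain u v where "e = {u, v}" "u \<in> V" "v \<in> V" "u \<noteq> v"
    unfolding LARG_graph_def LARG_pairs_def by auto
  then show "\<exists>u\<in>fst (LARG_graph V \<delta> \<omega>). \<exists>v\<in>fst (LARG_graph V \<delta> \<omega>). u \<noteq> v \<and> e = {u, v}"
    unfolding LARG_graph_def by auto
qed

context generic_sequence
begin

lemma inj_x: "inj x"
proof (rule injI, rule ccontr)
  fix i j assume "x i = x j" "i \<noteq> j"
  then show False using coord_neq[of i j 0] by simp
qed

text \<open>The pi-base and the countably many finite index sets \<open>S\<close>, \<open>T\<close>
  reduce the extension property to countably many almost sure events.\<close>

lemma AE_extensible_LARG:
  assumes p: "p \<in> {0<..<1}" and dense: "\<And>U. open U \<Longrightarrow> U \<noteq> {} \<Longrightarrow> infinite {i. x i \<in> U}"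
  shows "AE \<omega> in LARG_space (range x) d p.
    extensible (\<lambda>i j. {x i, x j} \<in> snd (LARG_graph (range x) d \<omega>))"
proof -
  obtain \<B> :: "c0 set set" where \<B>: "countable \<B>" "\<And>B. B \<in> \<B> \<Longrightarrow> open B \<and> B \<noteq> {}"
    "\<And>U. open U \<Longrightarrow> U \<noteq> {} \<Longrightarrow> \<exists>B\<in>\<B>. B \<subseteq> U"
    using countable_open_base_c0 by blast
  define good where "good B S T \<omega> \<longleftrightarrow> infinite {v \<in> (range x \<inter> B) - x ` (S \<union> T).
      (\<forall>s\<in>x ` S. \<omega> {v, s}) \<and> (\<forall>t\<in>x ` T. \<not> \<omega> {v, t})}" for B S T \<omega>
  have "AE \<omega> in LARG_space (range x) d p. S \<inter> T = {} \<and> (\<forall>y\<in>B. \<forall>j\<in>S \<union> T. norm (y - x j) < d) \<longrightarrow> good B S T \<omega>"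
    if B: "B \<in> \<B>" and fin: "S \<in> {S. finite S}" "T \<in> {T. finite T}" for B S T
  proof (rule AE_impI)
    assume ST: "S \<inter> T = {} \<and> (\<forall>y\<in>B. \<forall>j\<in>S \<union> T. norm (y - x j) < d)"
    show "AE \<omega> in LARG_space (range x) d p. good B S T \<omega>"
      unfolding good_def
    proof (rule AE_LARG_infinite_extension[OF p])
      have "range x \<inter> B = x ` {i. x i \<in> B}" by auto
      moreover have "infinite (x ` {i. x i \<in> B})"
        using dense[of B] \<B>(2)[OF B] finite_imageD[OF _ inj_on_subset[OF inj_x]] by blast
      ultimately show "infinite (range x \<inter> B - x ` (S \<union> T))"
        using fin by simp
      show "finite (x ` S)" "finite (x ` T)" using fin by auto
      show "x ` S \<inter> x ` T = {}" using ST inj_x by (auto simp: inj_eq)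
      show "(range x \<inter> B - x ` (S \<union> T)) \<inter> (x ` S \<union> x ` T) = {}" by auto
      show "{v, b} \<in> LARG_pairs (range x) d"
        if "v \<in> range x \<inter> B - x ` (S \<union> T)" "b \<in> x ` S \<union> x ` T" for v b
        using that ST by (auto simp: doubleton_in_LARG_pairs)
    qed
  qed
  then have "AE \<omega> in LARG_space (range x) d p. \<forall>B\<in>\<B>. \<forall>S\<in>{S. finite S}. \<forall>T\<in>{T. finite T}.
      S \<inter> T = {} \<and> (\<forall>y\<in>B. \<forall>j\<in>S \<union> T. norm (y - x j) < d) \<longrightarrow> good B S T \<omega>"
    using \<B>(1) countable_Collect_finite
    by (intro AE_ball_countable[THEN iffD2] ballI)
  then show ?thesis
  proof eventually_elim
    case (elim \<omega>)
    let ?e = "\<lambda>i j. {x i, x j} \<in> snd (LARG_graph (range x) d \<omega>)"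
    have e_iff: "?e i j \<longleftrightarrow> i \<noteq> j \<and> norm (x i - x j) < d \<and> \<omega> {x i, x j}" for i j
      using inj_x by (auto simp: LARG_graph_def doubleton_in_LARG_pairs inj_eq)
    show ?case
      unfolding extensible_def
    proof (intro conjI allI impI; (elim conjE)?)
      fix i j assume "?e i j"
      then show "?e j i" "i \<noteq> j" "norm (x i - x j) < d"
        by (auto simp: e_iff insert_commute norm_minus_commute)
    next
      fix U S T assume U: "open U" "U \<noteq> {}" and ST: "finite S" "finite T" "S \<inter> T = {}"
        and near: "\<forall>y\<in>U. \<forall>j\<in>S \<union> T. norm (y - x j) < d"
      obtain B where B: "B \<in> \<B>" "B \<subseteq> U" using \<B>(3)[OF U] by blast
      have "good B S T \<omega>" using elim B ST near by blast
      moreover have "{v \<in> (range x \<inter> B) - x ` (S \<union> T). (\<forall>s\<in>x ` S. \<omega> {v, s}) \<and> (\<forall>t\<in>x ` T. \<not> \<omega> {v, t})}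
          \<subseteq> x ` {k. x k \<in> U \<and> (\<forall>s\<in>S. ?e k s) \<and> (\<forall>t\<in>T. \<not> ?e k t)}"
        using B near by (auto simp: e_iff subset_iff)
      ultimately show "infinite {k. x k \<in> U \<and> (\<forall>s\<in>S. ?e k s) \<and> (\<forall>t\<in>T. \<not> ?e k t)}"
        unfolding good_def using finite_surj by blast
    qed
  qed
qed

lemma LARG_graph_iso:
  assumes "extensible (\<lambda>i j. {x i, x j} \<in> snd (LARG_graph (range x) d \<omega>))"
    and "extensible (\<lambda>i j. {x i, x j} \<in> snd (LARG_graph (range x) d \<omega>'))"
  shows "graph_iso (LARG_graph (range x) d \<omega>) (LARG_graph (range x) d \<omega>')"
proof -
  obtain f where f: "bij f" "\<And>i j. {x i, x j} \<in> snd (LARG_graph (range x) d \<omega>) \<longleftrightarrow>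
      {x (f i), x (f j)} \<in> snd (LARG_graph (range x) d \<omega>')"
    using extensible_iso[OF assms] by blast
  have x: "bij_betw x UNIV (range x)" "bij_betw (inv x) (range x) UNIV"
    using inj_x by (auto intro: inj_imp_bij_betw_inv inj_on_imp_bij_betw)
  have "bij_betw (x \<circ> (f \<circ> inv x)) (range x) (range x)"
    using f(1) x by (intro bij_betw_trans)
  then show ?thesis
    unfolding graph_iso_def using f(2) inj_x
    by (intro exI[of _ "x \<circ> (f \<circ> inv x)"]) (auto simp: LARG_graph_def)
qed

text \<open>Any two extensible samples are isomorphic, so one of them, which exists because an
  almost sure event is nonempty, can serve as \<open>\<Gamma>\<close>.\<close>

lemma AE_LARG_graph_iso:
  assumes p: "p \<in> {0<..<1}" and dense: "\<And>U. open U \<Longrightarrow> U \<noteq> {} \<Longrightarrow> infinite {i. x i \<in> U}"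
  shows "\<exists>\<Gamma> :: c0 graph. simple_graph \<Gamma> \<and>
    (AE \<omega> in LARG_space (range x) d p. graph_iso (LARG_graph (range x) d \<omega>) \<Gamma>)"
proof -
  have ae: "AE \<omega> in LARG_space (range x) d p.
      extensible (\<lambda>i j. {x i, x j} \<in> snd (LARG_graph (range x) d \<omega>))"
    using assms by (rule AE_extensible_LARG)
  interpret prob_space "LARG_space (range x) d p"
    unfolding LARG_space_def by (intro prob_space_PiM measure_pmf.prob_space_axioms)
  obtain \<omega>\<^sub>0 where \<omega>\<^sub>0: "extensible (\<lambda>i j. {x i, x j} \<in> snd (LARG_graph (range x) d \<omega>\<^sub>0))"
    using eventually_happens'[OF ae_filter_bot ae] by blast
  have "AE \<omega> in LARG_space (range x) d p.
      graph_iso (LARG_graph (range x) d \<omega>) (LARG_graph (range x) d \<omega>\<^sub>0)"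
    using ae by eventually_elim (rule LARG_graph_iso[OF _ \<omega>\<^sub>0])
  then show ?thesis
    using simple_graph_LARG_graph by blast
qed

end

section \<open>Genericity at an arbitrary threshold, and conclusion\<close>

text \<open>Two differences that are integer multiples of \<open>d\<close>, the first nonzero, have
  a rational quotient from which \<open>d\<close> has disappeared; the generic hypothesis forbids
  this for different pairs of indices. So \<open>X\<close> is empty or a single pair.\<close>

lemma generic_sequenceI:
  assumes d: "0 < d"
    and generic: "\<forall>i j k l m n. \<forall>q\<in>\<rat>. i \<notin> {j, k, l} \<longrightarrow>
      coord (x i) n \<noteq> coord (x j) n + q * (coord (x k) m - coord (x l) m)"
    and sorted: "\<forall>js. distinct js \<longrightarrow> infinite {n. sorted_wrt (<) (map (\<lambda>j. coord (x j) n) js)}"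
  shows "\<exists>X. generic_sequence x d X"
proof -
  have gen: "coord (x i) n \<noteq> coord (x j) n + q * (coord (x k) m - coord (x l) m)"
    if "i \<notin> {j, k, l}" "q \<in> \<rat>" for i j k l m n q
    by (rule generic[rule_format, OF that(2,1)])
  have neq: "coord (x i) n \<noteq> coord (x j) n" if "i \<noteq> j" for i j n
    using gen[of i j j j 0 n n] that by simp
  define tie where "tie i j n \<longleftrightarrow> (coord (x i) n - coord (x j) n) / d \<in> \<int>" for i j n
  have tie_sym: "tie j i n" if "tie i j n" for i j n
  proof -
    have "(coord (x j) n - coord (x i) n) / d = - ((coord (x i) n - coord (x j) n) / d)"
      by (simp add: diff_divide_distrib)
    then show ?thesis using that by (simp only: tie_def Ints_minus)
  qed
  have tie_unique: "i' \<in> {i, j}" if ij: "i \<noteq> j" "tie i j n" and ij': "i' \<noteq> j'" "tie i' j' n'" for i j n i' j' n'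
  proof (rule ccontr)
    assume "i' \<notin> {i, j}"
    obtain a b :: int where a: "coord (x i) n - coord (x j) n = of_int a * d"
      and b: "coord (x i') n' - coord (x j') n' = of_int b * d"
      using ij ij' d by (auto simp: tie_def elim!: Ints_cases simp: divide_eq_eq)
    \<comment> \<open>Distinct coordinates give a nonzero multiple, so \<open>a\<close> may be
      divided by to eliminate \<open>d\<close>.\<close>
    have "a \<noteq> 0" using a neq[OF \<open>i \<noteq> j\<close>, of n] by auto
    then have "coord (x i') n' = coord (x j') n' + of_int b / of_int a * (coord (x i) n - coord (x j) n)"
      using a b by (simp add: field_simps)
    moreover have "real_of_int b / of_int a \<in> \<rat>" by simp
    ultimately show False
      using gen[of i' j' i j "of_int b / of_int a" n' n] \<open>i' \<notin> {i, j}\<close> \<open>i' \<noteq> j'\<close> by auto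
  qed
  define X where "X = {i. \<exists>j n. i \<noteq> j \<and> tie i j n}"
  have X_pair: "X = {i, j}" if "i \<noteq> j" "tie i j n" for i j n
    using that tie_unique[OF that] tie_sym[OF that(2)] by (fastforce simp: X_def)
  have "generic_sequence x d X"
  proof
    show "0 < d" by fact
    show "finite X"
    proof (cases "X = {}")
      case False
      then obtain i j n where "i \<noteq> j" "tie i j n" by (auto simp: X_def)
      then show ?thesis using X_pair by simp
    qed simp
    show "coord (x i) n \<noteq> coord (x j) n" if "i \<noteq> j" for i j n
      using neq that .
    show "(coord (x i) n - coord (x j) n) / d \<notin> \<int>" if "i \<noteq> j" "i \<notin> X \<or> j \<notin> X" for i j n
    proof
      assume "(coord (x i) n - coord (x j) n) / d \<in> \<int>"
      then have "tie i j n" by (simp add: tie_def)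
      with X_pair[OF that(1)] that(2) show False by simp
    qed
    show "d \<le> norm (x i - x j)" if "i \<in> X" "j \<in> X" "i \<noteq> j" for i j
    proof -
      obtain k n where k: "i \<noteq> k" "tie i k n" using \<open>i \<in> X\<close> by (auto simp: X_def)
      then have "k = j" using X_pair[OF k] that by auto
      then obtain a :: int where a: "coord (x i) n - coord (x j) n = of_int a * d"
        using k d by (auto simp: tie_def elim!: Ints_cases simp: divide_eq_eq)
      then have "a \<noteq> 0" using neq[OF \<open>i \<noteq> j\<close>, of n] by auto
      \<comment> \<open>A nonzero integer multiple of \<open>d\<close> has absolute value at least
        \<open>d\<close>, so a tied pair is too far apart for an edge.\<close>
      then have "1 \<le> \<bar>real_of_int a\<bar>" by linarith
      then have "d \<le> \<bar>of_int a * d\<bar>" using d by (simp add: abs_mult)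
      also have "\<dots> \<le> norm (x i - x j)"
        using abs_coord_le_norm[of "x i - x j" n] a by simp
      finally show ?thesis .
    qed
    show "infinite {n. sorted_wrt (<) (map (\<lambda>j. coord (x j) n) js)}" if "distinct js" for js
      using sorted that by blast
  qed
  then show ?thesis by blast
qed

theorem theorem1p2:
  fixes \<mu> :: "c0 measure"
  assumes "borel_prob \<mu>"
    and "non_aligned \<mu>"
    and "fully_supported \<mu>"
    and "product_type \<mu>"
  shows "AE x in (\<Pi>\<^sub>M i\<in>(UNIV :: nat set). \<mu>). Rado (range x)"
  using AE_infinite_in_open[OF assms(1,3)] AE_no_coincidence[OF assms(1,2)]
    AE_infinite_coord_sorted[OF assms(1,2,4)]
proof eventually_elim
  case (elim x)
  have dense: "infinite {i. x i \<in> U}" if "open U" "U \<noteq> {}" for U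
    using elim(1) that by blast
  have "- closure (range x) = {}"
  proof (rule ccontr)
    assume "- closure (range x) \<noteq> {}"
    then have "infinite {i. x i \<in> - closure (range x)}"
      by (intro dense) auto
    moreover have "{i. x i \<in> - closure (range x)} = {}"
      using closure_subset[of "range x"] by auto
    ultimately show False by simp
  qed
  \<comment> \<open>The three almost sure properties mention neither \<open>\<delta>\<close> nor
    \<open>p\<close>, so one null set of samples serves all thresholds and probabilities.\<close>
  moreover have "\<exists>\<Gamma> :: c0 graph. simple_graph \<Gamma> \<and>
      (AE \<omega> in LARG_space (range x) \<delta> p. graph_iso (LARG_graph (range x) \<delta> \<omega>) \<Gamma>)"
    if "0 < \<delta>" "p \<in> {0<..<1}" for \<delta> p
    using generic_sequenceI[OF that(1) elim(2,3)] generic_sequence.AE_LARG_graph_iso[OF _ that(2) dense]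
    by blast
  ultimately show ?case
    by (auto simp: Rado_def)
qed

end
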